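(* Let $T\in\mathcal{E}'(\mathbb{R})$ and let $\mathcal{C}_T\colon\mathcal{E}'(\mathbb{R})\to\mathcal{E}'(\mathbb{R})$, $\mathcal{C}_TS=T\star S$. Then: (1) $\mathcal{C}_T\colon\mathcal{E}'(\mathbb{R})\to\mathcal{E}'(\mathbb{R})$ is power bounded if and only if $\{(\star T)^n\}_{n\in\mathbb{N}}$ is a bounded sequence of $\mathcal{E}'(\mathbb{R})$. (2) $\mathcal{C}_T\colon\mathcal{E}'(\mathbb{R})\to\mathcal{E}'(\mathbb{R})$ is mean ergodic if and only if $\{(\star T)_{[n]}\}_{n\in\mathbb{N}}$ is a convergent sequence of $\mathcal{E}'(\mathbb{R})$.
   Context: Functions are complex-valued. $C^\infty(\mathbb{R})$ carries its usual Fréchet topology, generated by the seminorms $\sup_{x\in K}\sup_{0\le i\le m}|f^{(i)}(x)|$, $K\subset\mathbb{R}$ compact, $m\in\mathbb{N}$. $\mathcal{E}'(\mathbb{R})$ is its strong dual (distributions with compact support). For $T\in\mathcal{E}'(\mathbb{R})$ and $f\in C^\infty(\mathbb{R})$, $(T\star f)(x)=\langle T_y,f(x-y)\rangle$, $x\in\mathbb{R}$. For $T,S\in\mathcal{E}'(\mathbb{R})$ the convolution $T\star S\in\mathcal{E}'(\mathbb{R})$ is given by $\langle T\star S,f\rangle=\langle S,\check T\star f\rangle$, $f\in C^\infty(\mathbb{R})$, where $\langle\check T,\varphi\rangle=\langle T,\check\varphi\rangle$ and $\check\varphi(y)=\varphi(-y)$. Set $(\star T)^1=T$, $(\star T)^n=T\star(\star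 T)^{n-1}$ for $n\ge2$, and $(\star T)_{[n]}=\frac1n\sum_{m=1}^n(\star T)^m$. For a locally convex Hausdorff space $E$, $\mathcal{L}(E)$ is the space of continuous linear operators on $E$. $A\in\mathcal{L}(E)$ is power bounded if $\{A^n\}_{n\in\mathbb{N}}$ is equicontinuous in $\mathcal{L}(E)$; $A$ is mean ergodic if its Cesàro means $A_{[n]}=\frac1n\sum_{m=1}^nA^m$, $n\in\mathbb{N}$, converge in $\mathcal{L}(E)$ with respect to the strong operator topology (pointwise convergence on $E$), the limit being in $\mathcal{L}(E)$. *)

theory Defs
  imports "HOL-Analysis.Analysis"
begin

section \<open>Complex locally convex Hausdorff spaces\<close>

class scaleC =
  fixes scaleC :: "complex \<Rightarrow> 'a \<Rightarrow> 'a"  (infixr \<open>*\<^sub>C\<close> 75)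

class complex_lcs = topological_ab_group_add + t2_space + scaleC +
  assumes scaleC_add_right: "c *\<^sub>C (x + y) = c *\<^sub>C x + c *\<^sub>C y"
    and scaleC_add_left: "(c + d) *\<^sub>C x = c *\<^sub>C x + d *\<^sub>C x"
    and scaleC_scaleC: "c *\<^sub>C d *\<^sub>C x = (c * d) *\<^sub>C x"
    and scaleC_one: "1 *\<^sub>C x = x"
    and tendsto_scaleC_Pair:
      "LIM z (nhds c \<times>\<^sub>F nhds x). fst z *\<^sub>C snd z :> nhds (c *\<^sub>C x)"
    and locally_convex: "open U \<Longrightarrow> 0 \<in> U \<Longrightarrow>
      \<exists>V. open V \<and> 0 \<in> V \<and> V \<subseteq> U \<and>
        (\<forall>x\<in>V. \<forall>y\<in>V. \<forall>t\<in>{0..1::real}. of_real t *\<^sub>C x + of_real (1 - t) *\<^sub>C y \<in> V)"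

text \<open>Von Neumann boundedness: every neighbourhood of the origin absorbs the set.\<close>

definition lcs_bounded :: "'a::complex_lcs set \<Rightarrow> bool" where
  "lcs_bounded B \<longleftrightarrow>
    (\<forall>U. open U \<and> 0 \<in> U \<longrightarrow> (\<exists>r>0. \<forall>c. r \<le> cmod c \<longrightarrow> B \<subseteq> (\<lambda>x. c *\<^sub>C x) ` U))"

definition continuous_linear_operators :: "('a::complex_lcs \<Rightarrow> 'a) set" where
  "continuous_linear_operators =
    {A. Vector_Spaces.linear (*\<^sub>C) (*\<^sub>C) A \<and> continuous_on UNIV A}"

text \<open>For linear operators, equicontinuity and equicontinuity at the origin coincide.\<close>

definition equicontinuous :: "('a::complex_lcs \<Rightarrow> 'a) set \<Rightarrow> bool" where
  "equicontinuous H \<longleftrightarrow> H \<subseteq> continuous_linear_operators \<and>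
    (\<forall>V. open V \<and> 0 \<in> V \<longrightarrow> (\<exists>U. open U \<and> 0 \<in> U \<and> (\<forall>A\<in>H. A ` U \<subseteq> V)))"

definition power_bounded :: "('a::complex_lcs \<Rightarrow> 'a) \<Rightarrow> bool" where
  "power_bounded A \<longleftrightarrow> A \<in> continuous_linear_operators \<and> equicontinuous {A ^^ n |n. 1 \<le> n}"

definition cesaro_mean :: "('a::complex_lcs \<Rightarrow> 'a) \<Rightarrow> nat \<Rightarrow> 'a \<Rightarrow> 'a" where
  "cesaro_mean A n x = (1 / of_nat n) *\<^sub>C (\<Sum>m = 1..n. (A ^^ m) x)"

definition mean_ergodic :: "('a::complex_lcs \<Rightarrow> 'a) \<Rightarrow> bool" where
  "mean_ergodic A \<longleftrightarrow> A \<in> continuous_linear_operators \<and>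
    (\<exists>P\<in>continuous_linear_operators. \<forall>x. (\<lambda>n. cesaro_mean A n x) \<longlonglongrightarrow> P x)"

section \<open>Topologies generated by seminorms\<close>

text \<open>The members of the family are not assumed directed, hence the finite subfamilies.\<close>

definition seminorm_open :: "('a::ab_group_add \<Rightarrow> real) set \<Rightarrow> 'a set \<Rightarrow> bool" where
  "seminorm_open P U \<longleftrightarrow>
    (\<forall>x\<in>U. \<exists>F e. finite F \<and> F \<subseteq> P \<and> 0 < e \<and> {y. \<forall>p\<in>F. p (y - x) < e} \<subseteq> U)"

lemma seminorm_open_UNIV: "seminorm_open P UNIV"
  unfolding seminorm_open_def by (auto intro!: exI[of _ "{}"] exI[of _ "1::real"])

lemma seminorm_open_Int:
  assumes "seminorm_open P U" "seminorm_open P V"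
  shows "seminorm_open P (U \<inter> V)"
  unfolding seminorm_open_def
proof
  fix x assume "x \<in> U \<inter> V"
  then obtain F e G d where
    "finite F" "F \<subseteq> P" "0 < e" "{y. \<forall>p\<in>F. p (y - x) < e} \<subseteq> U"
    "finite G" "G \<subseteq> P" "0 < d" "{y. \<forall>p\<in>G. p (y - x) < d} \<subseteq> V"
    using assms unfolding seminorm_open_def by (meson IntD1 IntD2)
  then show "\<exists>F e. finite F \<and> F \<subseteq> P \<and> 0 < e \<and> {y. \<forall>p\<in>F. p (y - x) < e} \<subseteq> U \<inter> V"
    by (intro exI[of _ "F \<union> G"] exI[of _ "min e d"]) auto
qed

lemma seminorm_open_Union:
  assumes "\<forall>U\<in>\<U>. seminorm_open P U"
  shows "seminorm_open P (\<Union>\<U>)"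
  unfolding seminorm_open_def
proof
  fix x assume "x \<in> \<Union>\<U>"
  then obtain U where U: "U \<in> \<U>" "x \<in> U" by blast
  with assms obtain F e where
    "finite F" "F \<subseteq> P" "0 < e" "{y. \<forall>p\<in>F. p (y - x) < e} \<subseteq> U"
    unfolding seminorm_open_def by meson
  then show "\<exists>F e. finite F \<and> F \<subseteq> P \<and> 0 < e \<and> {y. \<forall>p\<in>F. p (y - x) < e} \<subseteq> \<Union>\<U>"
    using U by (intro exI[of _ F] exI[of _ e]) auto
qed

locale seminorm_space =
  fixes P :: "('a::{ab_group_add, topological_space, scaleC} \<Rightarrow> real) set"
  assumes opens: "open (U :: 'a set) \<longleftrightarrow> seminorm_open P U"
    and triangle: "p \<in> P \<Longrightarrow> p (x + y) \<le> p x + p y"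
    and homogeneous: "p \<in> P \<Longrightarrow> p (c *\<^sub>C x) = cmod c * p x"
    and separating: "(\<And>p. p \<in> P \<Longrightarrow> p x = 0) \<Longrightarrow> x = 0"
    and scale_add_right: "c *\<^sub>C (x + y :: 'a) = c *\<^sub>C x + c *\<^sub>C y"
    and scale_add_left: "(c + d) *\<^sub>C (x :: 'a) = c *\<^sub>C x + d *\<^sub>C x"
    and scale_scale: "c *\<^sub>C d *\<^sub>C (x :: 'a) = (c * d) *\<^sub>C x"
    and scale_one: "1 *\<^sub>C x = (x :: 'a)"
begin

lemma scale_zero_left: "0 *\<^sub>C x = (0 :: 'a)"
  using scale_add_left[of 0 0 x] by simp

lemma scale_minus_left: "(-c) *\<^sub>C (x :: 'a) = - (c *\<^sub>C x)"
  using scale_add_left[of "-c" c x] scale_zero_left[of x] by (simp add: eq_neg_iff_add_eq_0)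

lemma scale_zero_right: "c *\<^sub>C 0 = (0 :: 'a)"
  using scale_add_right[of c 0 0] by simp

lemma scale_minus_right: "c *\<^sub>C (- x :: 'a) = - (c *\<^sub>C x)"
  using scale_add_right[of c "-x" x] scale_zero_right[of c] by (simp add: eq_neg_iff_add_eq_0)

lemma zero: "p \<in> P \<Longrightarrow> p 0 = 0"
  using homogeneous[of p 0 0] by (simp add: scale_zero_left)

lemma minus: "p \<in> P \<Longrightarrow> p (- x) = p x"
  using homogeneous[of p "-1" x] by (simp add: scale_minus_left scale_one)

lemma nonneg: assumes "p \<in> P" shows "0 \<le> p x"
  using triangle[OF assms, of x "- x"] by (simp add: assms zero minus)

lemma open_ball:
  assumes F: "finite F" "F \<subseteq> P"
  shows "open {y. \<forall>p\<in>F. p (y - x) < e}"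
  unfolding opens seminorm_open_def
proof
  fix y assume y: "y \<in> {y. \<forall>p\<in>F. p (y - x) < e}"
  define d where "d = Min (insert 1 ((\<lambda>p. e - p (y - x)) ` F))"
  have d: "d > 0" using F y by (auto simp: d_def)
  have "p (z - x) < e" if p: "p \<in> F" and z: "p (z - y) < d" for z p
  proof -
    have "d \<le> e - p (y - x)" using F p by (auto simp: d_def)
    moreover have "p (z - x) \<le> p (z - y) + p (y - x)"
      using triangle[of p "z - y" "y - x"] F p by auto
    ultimately show ?thesis using z by linarith
  qed
  then show "\<exists>F' e'. finite F' \<and> F' \<subseteq> P \<and> 0 < e' \<and>
      {z. \<forall>p\<in>F'. p (z - y) < e'} \<subseteq> {y. \<forall>p\<in>F. p (y - x) < e}"
    using d F by (intro exI[of _ F] exI[of _ d]) auto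
qed

lemma mem_ball:
  assumes "F \<subseteq> P" "0 < e"
  shows "x \<in> {y. \<forall>p\<in>F. p (y - x) < e}"
proof -
  have "p (x - x) < e" if "p \<in> F" for p
  proof -
    have "p 0 = 0" using zero that assms(1) by blast
    then show ?thesis using assms(2) by simp
  qed
  then show ?thesis by blast
qed

lemma open_nhd:
  assumes "open U" "(x :: 'a) \<in> U"
  obtains F e where "finite F" "F \<subseteq> P" "0 < e" "\<And>y. (\<And>p. p \<in> F \<Longrightarrow> p (y - x) < e) \<Longrightarrow> y \<in> U"
proof -
  have "seminorm_open P U" using assms(1) by (simp add: opens)
  from bspec[OF this[unfolded seminorm_open_def] assms(2)]
  obtain F e where "finite F" "F \<subseteq> P" "0 < e" "{y. \<forall>p\<in>F. p (y - x) < e} \<subseteq> U"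
    by (elim exE conjE)
  then show thesis by (intro that[of F e]) auto
qed

lemma tendsto_iff_seminorms:
  "(f \<longlongrightarrow> l) G \<longleftrightarrow> (\<forall>p\<in>P. ((\<lambda>z. p (f z - l)) \<longlongrightarrow> 0) G)"
proof
  assume f: "(f \<longlongrightarrow> l) G"
  show "\<forall>p\<in>P. ((\<lambda>z. p (f z - l)) \<longlongrightarrow> 0) G"
  proof
    fix p assume p: "p \<in> P"
    show "((\<lambda>z. p (f z - l)) \<longlongrightarrow> 0) G"
    proof (rule tendstoI)
      fix e :: real assume e: "0 < e"
      have "\<forall>\<^sub>F z in G. f z \<in> {y. \<forall>q\<in>{p}. q (y - l) < e}"
        using p e mem_ball[of "{p}" e l] by (intro topological_tendstoD[OF f] open_ball) auto
      then show "\<forall>\<^sub>F z in G. dist (p (f z - l)) 0 < e"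
        by (rule eventually_mono) (use p nonneg in auto)
    qed
  qed
next
  assume *: "\<forall>p\<in>P. ((\<lambda>z. p (f z - l)) \<longlongrightarrow> 0) G"
  show "(f \<longlongrightarrow> l) G"
  proof (rule topological_tendstoI)
    fix U assume "open U" "l \<in> U"
    then obtain F e where F: "finite F" "F \<subseteq> P" "0 < e"
      and U: "\<And>y. (\<And>p. p \<in> F \<Longrightarrow> p (y - l) < e) \<Longrightarrow> y \<in> U"
      by (rule open_nhd) blast
    have "\<forall>\<^sub>F z in G. \<forall>p\<in>F. p (f z - l) < e"
      using F * by (auto intro!: eventually_ball_finite order_tendstoD(2))
    then show "\<forall>\<^sub>F z in G. f z \<in> U"
      by (rule eventually_mono) (use U in auto)
  qed
qed

lemma tendsto_nhds_seminorm:
  assumes p: "p \<in> P" and G: "filterlim g (nhds a) G"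
  shows "((\<lambda>z. p (g z - a)) \<longlongrightarrow> 0) G"
  using G p tendsto_iff_seminorms by blast

lemma tendsto_add_pair: "LIM z (nhds a \<times>\<^sub>F nhds b). fst z + snd z :> nhds (a + b :: 'a)"
  unfolding tendsto_iff_seminorms
proof
  fix p assume p: "p \<in> P"
  have "((\<lambda>z. p (fst z - a) + p (snd z - b)) \<longlongrightarrow> 0 + 0) (nhds a \<times>\<^sub>F nhds b)"
    by (intro tendsto_add tendsto_nhds_seminorm[OF p] filterlim_fst filterlim_snd)
  then have "((\<lambda>z. p (fst z - a) + p (snd z - b)) \<longlongrightarrow> 0) (nhds a \<times>\<^sub>F nhds b)"
    by simp
  then show "((\<lambda>z. p (fst z + snd z - (a + b))) \<longlongrightarrow> 0) (nhds a \<times>\<^sub>F nhds b)"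
  proof (rule tendsto_sandwich[OF _ _ tendsto_const, rotated 2])
    show "\<forall>\<^sub>F z in nhds a \<times>\<^sub>F nhds b. p (fst z + snd z - (a + b)) \<le> p (fst z - a) + p (snd z - b)"
      using triangle[OF p, of "fst z - a" "snd z - b" for z] by (simp add: add_diff_add)
  qed (simp add: nonneg p)
qed

lemma tendsto_uminus: "(uminus \<longlongrightarrow> - a) (nhds (a :: 'a))"
  unfolding tendsto_iff_seminorms
proof
  fix p assume p: "p \<in> P"
  have "p (- z - - a) = p (z - a)" for z
    using minus[OF p, of "z - a"] by (simp add: add.commute)
  then show "((\<lambda>z. p (- z - - a)) \<longlongrightarrow> 0) (nhds a)"
    using tendsto_nhds_seminorm[OF p, of "\<lambda>z. z" a "nhds a"] by (simp add: filterlim_ident)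
qed

lemma tendsto_scale_pair: "LIM z (nhds c \<times>\<^sub>F nhds x). fst z *\<^sub>C snd z :> nhds (c *\<^sub>C x :: 'a)"
  unfolding tendsto_iff_seminorms
proof
  fix p assume p: "p \<in> P"
  let ?G = "nhds c \<times>\<^sub>F nhds x"
  have c: "(fst \<longlongrightarrow> c) ?G" by (rule filterlim_fst)
  have "((\<lambda>z. cmod (fst z) * p (snd z - x) + cmod (fst z - c) * p x) \<longlongrightarrow>
      cmod c * 0 + cmod (c - c) * p x) ?G"
    by (intro tendsto_add tendsto_mult tendsto_const tendsto_norm tendsto_diff c
        tendsto_nhds_seminorm[OF p] filterlim_snd)
  then have "((\<lambda>z. cmod (fst z) * p (snd z - x) + cmod (fst z - c) * p x) \<longlongrightarrow> 0) ?G"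
    by simp
  then show "((\<lambda>z. p (fst z *\<^sub>C snd z - c *\<^sub>C x)) \<longlongrightarrow> 0) ?G"
  proof (rule tendsto_sandwich[OF _ _ tendsto_const, rotated 2])
    have "p (d *\<^sub>C y - c *\<^sub>C x) \<le> cmod d * p (y - x) + cmod (d - c) * p x" for d y
    proof -
      have "d *\<^sub>C y - c *\<^sub>C x = d *\<^sub>C (y - x) + (d - c) *\<^sub>C x"
        using scale_add_right[of d y "-x"] scale_add_left[of d "-c" x]
        by (simp add: scale_minus_left scale_minus_right)
      then show ?thesis using triangle[OF p] by (simp add: homogeneous[OF p, symmetric])
    qed
    then show "\<forall>\<^sub>F z in ?G. p (fst z *\<^sub>C snd z - c *\<^sub>C x) \<le>
        cmod (fst z) * p (snd z - x) + cmod (fst z - c) * p x" by simp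
  qed (simp add: nonneg p)
qed

lemma hausdorff:
  assumes "x \<noteq> (y :: 'a)"
  shows "\<exists>U V. open U \<and> open V \<and> x \<in> U \<and> y \<in> V \<and> U \<inter> V = {}"
proof -
  from assms separating[of "x - y"] obtain p where p: "p \<in> P" "p (x - y) \<noteq> 0" by auto
  define e where "e = p (x - y) / 2"
  have e: "e > 0" using p nonneg[of p "x - y"] by (simp add: e_def)
  let ?U = "\<lambda>x. {z. \<forall>q\<in>{p}. q (z - x) < e}"
  have "z \<notin> ?U y" if "z \<in> ?U x" for z
  proof
    assume "z \<in> ?U y"
    moreover have "p (x - y) \<le> p (x - z) + p (z - y)" using triangle[of p "x - z" "z - y"] p by simp
    moreover have "p (x - z) = p (z - x)" using minus[of p "z - x"] p by simp
    ultimately show False using that by (simp add: e_def)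
  qed
  then have "?U x \<inter> ?U y = {}" by blast
  then show ?thesis
    using open_ball[of "{p}"] mem_ball[of "{p}" e] p e
    by (intro exI[of _ "?U x"] exI[of _ "?U y"]) auto
qed

lemma convex_nhd:
  assumes "open U" "(0 :: 'a) \<in> U"
  shows "\<exists>V. open V \<and> 0 \<in> V \<and> V \<subseteq> U \<and>
    (\<forall>x\<in>V. \<forall>y\<in>V. \<forall>t\<in>{0..1::real}. of_real t *\<^sub>C x + of_real (1 - t) *\<^sub>C y \<in> V)"
proof -
  from assms obtain F e where F: "finite F" "F \<subseteq> P" "0 < e"
    and U: "\<And>y. (\<And>p. p \<in> F \<Longrightarrow> p (y - 0) < e) \<Longrightarrow> y \<in> U"
    by (rule open_nhd) blast
  let ?V = "{y. \<forall>p\<in>F. p (y - 0) < e}"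
  have "of_real t *\<^sub>C x + of_real (1 - t) *\<^sub>C y \<in> ?V"
    if x: "x \<in> ?V" and y: "y \<in> ?V" and t: "t \<in> {0..1}" for x y and t :: real
  proof -
    have "p (of_real t *\<^sub>C x + of_real (1 - t) *\<^sub>C y) < e" if p: "p \<in> F" for p
    proof -
      have "p (of_real t *\<^sub>C x + of_real (1 - t) *\<^sub>C y) \<le> t * p x + (1 - t) * p y"
        using triangle[of p "of_real t *\<^sub>C x" "of_real (1 - t) *\<^sub>C y"] F p t
          homogeneous[of p "of_real t" x] homogeneous[of p "of_real (1 - t)" y]
        by (simp add: subset_iff del: of_real_diff)
      also have "\<dots> < e"
      proof -
        have "p x < e" "p y < e" using x y p by auto
        then show ?thesis using t by (intro convex_bound_lt) auto
      qed
      finally show ?thesis .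
    qed
    then show ?thesis by simp
  qed
  then show ?thesis
    using open_ball[of F 0 e] mem_ball[of F e 0] F U by (intro exI[of _ ?V]) auto
qed

end

section \<open>The space of smooth functions\<close>

definition vderiv :: "(real \<Rightarrow> complex) \<Rightarrow> real \<Rightarrow> complex" where
  "vderiv f = (\<lambda>x. vector_derivative f (at x))"

definition smooth :: "(real \<Rightarrow> complex) \<Rightarrow> bool" where
  "smooth f \<longleftrightarrow> (\<forall>n x. (vderiv ^^ n) f differentiable at x)"

lemma smoothD:
  "smooth f \<Longrightarrow> ((vderiv ^^ n) f has_vector_derivative (vderiv ^^ Suc n) f x) (at x)"
  by (simp add: smooth_def vderiv_def vector_derivative_works[symmetric])

lemma vderiv_chain:
  assumes "\<And>n x. (g n has_vector_derivative g (Suc n) x) (at x)"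
  shows "(vderiv ^^ n) (g 0) = g n"
proof (induction n)
  case (Suc n)
  then show ?case using assms by (auto simp: vderiv_def vector_derivative_at)
qed simp

lemma smoothI:
  assumes "\<And>n x. (g n has_vector_derivative g (Suc n) x) (at x)"
  shows "smooth (g 0)"
  unfolding smooth_def vderiv_chain[of g, OF assms]
  using assms differentiableI_vector by blast

lemma continuous_on_vderiv: "smooth f \<Longrightarrow> continuous_on S ((vderiv ^^ n) f)"
  unfolding smooth_def
  by (meson continuous_at_imp_continuous_on differentiable_imp_continuous_within)

lemma smooth_vderiv: assumes "smooth f" shows "smooth ((vderiv ^^ k) f)"
proof -
  have "(vderiv ^^ n) ((vderiv ^^ k) f) = (vderiv ^^ (n + k)) f" for n
    by (simp add: funpow_add)
  then show ?thesis using assms by (simp add: smooth_def)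
qed

typedef Cinf = "{f. smooth f}"
  morphisms Cinf_fun Abs_Cinf
  using smoothI[of "\<lambda>_ _. 0"] by auto

setup_lifting type_definition_Cinf

lemma smooth_Cinf_fun: "smooth (Cinf_fun f)"
  using Cinf_fun by auto

lemma smooth_zero: "smooth (\<lambda>_. 0)"
  and vderiv_zero: "(vderiv ^^ n) (\<lambda>_. 0) = (\<lambda>_. 0)"
  using smoothI[of "\<lambda>_ _. 0"] vderiv_chain[of "\<lambda>_ _. 0"] by auto

lemma
  assumes "smooth f" "smooth g"
  shows smooth_add: "smooth (\<lambda>x. f x + g x)"
    and vderiv_add: "(vderiv ^^ n) (\<lambda>x. f x + g x) = (\<lambda>x. (vderiv ^^ n) f x + (vderiv ^^ n) g x)"
proof -
  let ?h = "\<lambda>n x. (vderiv ^^ n) f x + (vderiv ^^ n) g x"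
  have *: "(?h n has_vector_derivative ?h (Suc n) x) (at x)" for n x
    by (intro has_vector_derivative_add smoothD assms)
  show "smooth (\<lambda>x. f x + g x)"
    using smoothI[of ?h, OF *] by simp
  show "(vderiv ^^ n) (\<lambda>x. f x + g x) = ?h n"
    using vderiv_chain[of ?h n, OF *] by simp
qed

lemma
  assumes "smooth f"
  shows smooth_scale: "smooth (\<lambda>x. c * f x)"
    and vderiv_scale: "(vderiv ^^ n) (\<lambda>x. c * f x) = (\<lambda>x. c * (vderiv ^^ n) f x)"
proof -
  let ?h = "\<lambda>n x. c * (vderiv ^^ n) f x"
  have *: "(?h n has_vector_derivative ?h (Suc n) x) (at x)" for n x
    by (intro has_vector_derivative_mult_right smoothD assms)
  show "smooth (\<lambda>x. c * f x)"
    using smoothI[of ?h, OF *] by simp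
  show "(vderiv ^^ n) (\<lambda>x. c * f x) = ?h n"
    using vderiv_chain[of ?h n, OF *] by simp
qed

lemma
  assumes f: "smooth f"
  shows smooth_affine: "smooth (\<lambda>y. f (a + s * y))"
    and vderiv_affine:
      "(vderiv ^^ n) (\<lambda>y. f (a + s * y)) = (\<lambda>y. of_real (s ^ n) * (vderiv ^^ n) f (a + s * y))"
proof -
  let ?h = "\<lambda>n y. of_real (s ^ n) * (vderiv ^^ n) f (a + s * y)"
  have *: "(?h n has_vector_derivative ?h (Suc n) y) (at y)" for n y
  proof -
    have "((\<lambda>y. a + s * y) has_vector_derivative s) (at y)"
      by (auto intro!: derivative_eq_intros)
    from vector_diff_chain_at[OF this smoothD[OF f]]
    have "((\<lambda>y. (vderiv ^^ n) f (a + s * y)) has_vector_derivative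
        s *\<^sub>R (vderiv ^^ Suc n) f (a + s * y)) (at y)"
      by (simp add: o_def)
    from has_vector_derivative_mult_right[OF this, of "of_real (s ^ n)"]
    show ?thesis by (simp add: scaleR_conv_of_real mult_ac)
  qed
  show "smooth (\<lambda>y. f (a + s * y))"
    using smoothI[of ?h, OF *] by simp
  show "(vderiv ^^ n) (\<lambda>y. f (a + s * y)) = ?h n"
    using vderiv_chain[of ?h n, OF *] by simp
qed

instantiation Cinf :: "{ab_group_add, scaleC}"
begin

lift_definition zero_Cinf :: Cinf is "\<lambda>_. 0" by (rule smooth_zero)
lift_definition plus_Cinf :: "Cinf \<Rightarrow> Cinf \<Rightarrow> Cinf" is "\<lambda>f g x. f x + g x" by (rule smooth_add)
lift_definition uminus_Cinf :: "Cinf \<Rightarrow> Cinf" is "\<lambda>f x. - f x"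
  using smooth_scale[of _ "-1"] by simp
lift_definition minus_Cinf :: "Cinf \<Rightarrow> Cinf \<Rightarrow> Cinf" is "\<lambda>f g x. f x - g x"
  using smooth_add[OF _ smooth_scale[of _ "-1"]] by simp
lift_definition scaleC_Cinf :: "complex \<Rightarrow> Cinf \<Rightarrow> Cinf" is "\<lambda>c f x. c * f x"
  by (rule smooth_scale)

instance
  by standard (transfer; simp add: fun_eq_iff)+

end

text \<open>Empty index sets are left out because the supremum of the empty set of reals is unspecified.\<close>

definition Cinf_seminorm :: "real set \<Rightarrow> nat \<Rightarrow> Cinf \<Rightarrow> real" where
  "Cinf_seminorm K m f = (SUP x\<in>K. SUP i\<in>{..m}. cmod ((vderiv ^^ i) (Cinf_fun f) x))"

definition Cinf_seminorms :: "(Cinf \<Rightarrow> real) set" where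
  "Cinf_seminorms = {Cinf_seminorm K m |K m. compact K \<and> K \<noteq> {}}"

instantiation Cinf :: topological_space
begin

definition open_Cinf :: "Cinf set \<Rightarrow> bool" where
  "open_Cinf = seminorm_open Cinf_seminorms"

instance
  by standard (simp_all add: open_Cinf_def seminorm_open_UNIV seminorm_open_Int seminorm_open_Union)

end

lemma vderiv_bounded:
  assumes "compact K"
  obtains M where "\<And>x i. x \<in> K \<Longrightarrow> i \<le> m \<Longrightarrow> cmod ((vderiv ^^ i) (Cinf_fun f) x) \<le> M"
proof -
  have "bounded (\<Union>i\<le>m. (vderiv ^^ i) (Cinf_fun f) ` K)"
    using assms by (intro bounded_UN ballI compact_imp_bounded compact_continuous_image
        continuous_on_vderiv smooth_Cinf_fun) auto
  then obtain M where "\<forall>z\<in>(\<Union>i\<le>m. (vderiv ^^ i) (Cinf_fun f) ` K). cmod z \<le> M"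
    unfolding bounded_iff by blast
  then show thesis using that[of M] by auto
qed

lemma Cinf_seminorm_le_iff:
  assumes "compact K" "K \<noteq> {}"
  shows "Cinf_seminorm K m f \<le> b \<longleftrightarrow> (\<forall>x\<in>K. \<forall>i\<le>m. cmod ((vderiv ^^ i) (Cinf_fun f) x) \<le> b)"
proof -
  let ?v = "\<lambda>x i. cmod ((vderiv ^^ i) (Cinf_fun f) x)"
  obtain M where M: "\<And>x i. x \<in> K \<Longrightarrow> i \<le> m \<Longrightarrow> ?v x i \<le> M"
    using vderiv_bounded[OF assms(1)] by metis
  have inner: "(SUP i\<in>{..m}. ?v x i) \<le> c \<longleftrightarrow> (\<forall>i\<le>m. ?v x i \<le> c)" for x c
    by (subst cSUP_le_iff) auto
  have "bdd_above ((\<lambda>x. SUP i\<in>{..m}. ?v x i) ` K)"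
    using M inner by (intro bdd_aboveI[of _ M]) auto
  then show ?thesis
    unfolding Cinf_seminorm_def by (subst cSUP_le_iff) (use assms inner in auto)
qed

lemma Cinf_seminorm_upper:
  assumes "compact K" "x \<in> K" "i \<le> m"
  shows "cmod ((vderiv ^^ i) (Cinf_fun f) x) \<le> Cinf_seminorm K m f"
  using Cinf_seminorm_le_iff[of K m f "Cinf_seminorm K m f"] assms by auto

lemma Cinf_seminorm_nonneg:
  assumes "compact K" "K \<noteq> {}"
  shows "0 \<le> Cinf_seminorm K m f"
proof -
  from assms obtain x where "x \<in> K" by auto
  then show ?thesis
    using Cinf_seminorm_upper[OF assms(1), of x 0 m f] norm_ge_zero order_trans by blast
qed

interpretation Cinf: seminorm_space Cinf_seminorms
proof
  fix U :: "Cinf set" show "open U \<longleftrightarrow> seminorm_open Cinf_seminorms U"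
    by (simp add: open_Cinf_def)
next
  fix p and f g :: Cinf assume "p \<in> Cinf_seminorms"
  then obtain K m where K: "compact K" "K \<noteq> {}" and p: "p = Cinf_seminorm K m"
    by (auto simp: Cinf_seminorms_def)
  show "p (f + g) \<le> p f + p g"
    unfolding p Cinf_seminorm_le_iff[OF K]
    by (auto simp: plus_Cinf.rep_eq vderiv_add smooth_Cinf_fun
        intro!: norm_triangle_le add_mono Cinf_seminorm_upper K)
next
  fix p c and f :: Cinf assume "p \<in> Cinf_seminorms"
  then obtain K m where K: "compact K" "K \<noteq> {}" and p: "p = Cinf_seminorm K m"
    by (auto simp: Cinf_seminorms_def)
  have le: "p (c *\<^sub>C f) \<le> cmod c * p f" for c f
    unfolding p Cinf_seminorm_le_iff[OF K]
    by (auto simp: scaleC_Cinf.rep_eq vderiv_scale smooth_Cinf_fun norm_mult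
        intro!: mult_left_mono Cinf_seminorm_upper K)
  show "p (c *\<^sub>C f) = cmod c * p f"
  proof (cases "c = 0")
    case True
    then show ?thesis
      using le[of c f] Cinf_seminorm_nonneg[OF K, of m "c *\<^sub>C f"] by (simp add: p)
  next
    case False
    have "inverse c *\<^sub>C c *\<^sub>C f = f"
      using False by transfer (simp add: fun_eq_iff)
    then have "p f \<le> cmod (inverse c) * p (c *\<^sub>C f)"
      using le[of "inverse c" "c *\<^sub>C f"] by simp
    then have "cmod c * p f \<le> p (c *\<^sub>C f)"
      using False by (simp add: norm_divide field_simps)
    with le[of c f] show ?thesis by simp
  qed
next
  fix f :: Cinf assume *: "\<And>p. p \<in> Cinf_seminorms \<Longrightarrow> p f = 0"
  have "Cinf_fun f x = 0" for x
  proof -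
    have "Cinf_seminorm {x} 0 f = 0" by (rule *) (auto simp: Cinf_seminorms_def)
    then show ?thesis using Cinf_seminorm_upper[of "{x}" x 0 0 f] by simp
  qed
  then show "f = 0" by transfer auto
qed (transfer; simp add: fun_eq_iff algebra_simps)+

instance Cinf :: complex_lcs
  by standard (rule Cinf.tendsto_add_pair Cinf.tendsto_uminus Cinf.hausdorff Cinf.scale_add_right
      Cinf.scale_add_left Cinf.scale_scale Cinf.scale_one Cinf.tendsto_scale_pair Cinf.convex_nhd;
      assumption?)+

lemma vector_space_scaleC: "vector_space ((*\<^sub>C) :: complex \<Rightarrow> 'a \<Rightarrow> 'a::complex_lcs)"
  by standard (simp_all add: scaleC_add_right scaleC_add_left scaleC_scaleC scaleC_one)

lemma linear_functional_iff:
  fixes T :: "'a::complex_lcs \<Rightarrow> complex"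
  shows "Vector_Spaces.linear (*\<^sub>C) (*) T \<longleftrightarrow>
    (\<forall>x y. T (x + y) = T x + T y) \<and> (\<forall>c x. T (c *\<^sub>C x) = c * T x)"
proof -
  have "vector_space ((*) :: complex \<Rightarrow> complex \<Rightarrow> complex)"
    by standard (simp_all add: algebra_simps)
  then show ?thesis
    by (simp add: module_hom_iff_linear[symmetric] module_hom_def module_hom_axioms_def
        module_iff_vector_space vector_space_scaleC)
qed

lemma Cinf_seminorms_directed:
  assumes "finite F" "F \<subseteq> Cinf_seminorms"
  shows "\<exists>K m. compact K \<and> K \<noteq> {} \<and> (\<forall>p\<in>F. \<forall>f. p f \<le> Cinf_seminorm K m f)"
  using assms
proof (induction F rule: finite_induct)
  case empty
  show ?case by (intro exI[of _ "{0}"]) auto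
next
  case (insert p F)
  then obtain K m where K: "compact K" "K \<noteq> {}" "\<forall>p\<in>F. \<forall>f. p f \<le> Cinf_seminorm K m f"
    by auto
  from insert.prems obtain L n where L: "compact L" "L \<noteq> {}" "p = Cinf_seminorm L n"
    by (auto simp: Cinf_seminorms_def)
  have KL: "compact (K \<union> L)" "K \<union> L \<noteq> {}" using K L by auto
  have "Cinf_seminorm K m f \<le> Cinf_seminorm (K \<union> L) (max m n) f"
    and "Cinf_seminorm L n f \<le> Cinf_seminorm (K \<union> L) (max m n) f" for f
    using K(1,2) L(1,2) KL by (auto simp: Cinf_seminorm_le_iff intro!: Cinf_seminorm_upper)
  then have "\<forall>q\<in>insert p F. \<forall>f. q f \<le> Cinf_seminorm (K \<union> L) (max m n) f"
    using K(3) L(3) order_trans by (metis insert_iff)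
  then show ?case using KL by blast
qed

lemma continuous_functional_iff:
  assumes T: "Vector_Spaces.linear (*\<^sub>C) (*) T"
  shows "continuous_on UNIV T \<longleftrightarrow>
    (\<exists>R C m. 0 \<le> R \<and> 0 \<le> C \<and> (\<forall>f. cmod (T f) \<le> C * Cinf_seminorm (cball 0 R) m f))"
    (is "?L \<longleftrightarrow> ?R")
proof
  have add: "T (f + g) = T f + T g" and scale: "T (c *\<^sub>C f) = c * T f" for f g c
    using T unfolding linear_functional_iff by auto
  have T0: "T 0 = 0" using add[of 0 0] by simp
  {
    assume ?L
    then have "open (T -` ball 0 1)" by (simp add: open_vimage)
    moreover have "0 \<in> T -` ball 0 1" by (simp add: T0)
    ultimately obtain F e where F: "finite F" "F \<subseteq> Cinf_seminorms" "0 < e"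
      and lt: "\<And>y. (\<And>p. p \<in> F \<Longrightarrow> p (y - 0) < e) \<Longrightarrow> y \<in> T -` ball 0 1"
      by (rule Cinf.open_nhd) blast
    obtain K m where K: "compact K" "K \<noteq> {}" "\<forall>p\<in>F. \<forall>f. p f \<le> Cinf_seminorm K m f"
      using Cinf_seminorms_directed[OF F(1,2)] by auto
    obtain R where R: "0 < R" "K \<subseteq> cball 0 R"
      using bounded_subset_ballD[OF compact_imp_bounded[OF K(1)], of 0] ball_subset_cball by blast
    let ?q = "Cinf_seminorm (cball 0 R) m"
    have cb: "compact (cball (0::real) R)" "cball (0::real) R \<noteq> {}" using R by auto
    have Kq: "Cinf_seminorm K m f \<le> ?q f" for f
      using R K(1,2) cb by (auto simp: Cinf_seminorm_le_iff intro!: Cinf_seminorm_upper)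
    have q: "?q \<in> Cinf_seminorms" unfolding Cinf_seminorms_def using cb by blast
    have "cmod (T f) \<le> (1 / e) * ?q f" for f
    proof (rule field_le_epsilon)
      fix d :: real assume d: "0 < d"
      define r where "r = ?q f + e * d"
      have r: "r > 0" "?q f < r"
        using d F(3) Cinf.nonneg[OF q, of f] mult_pos_pos[of e d]
        by (auto simp: r_def add_nonneg_pos)
      have "?q (of_real (e / r) *\<^sub>C f) < e"
        unfolding Cinf.homogeneous[OF q] norm_of_real using r F(3) by (simp add: field_simps)
      then have "of_real (e / r) *\<^sub>C f \<in> T -` ball 0 1"
        using K(3) Kq by (intro lt) (metis diff_zero le_less_trans)
      then have "cmod (of_real (e / r) * T f) < 1" by (simp add: scale)
      then have "cmod (T f) < r / e" using r F(3) by (simp add: norm_mult norm_divide field_simps)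
      then show "cmod (T f) \<le> (1 / e) * ?q f + d" using F(3) by (simp add: r_def field_simps)
    qed
    then show ?R using F(3) R by (intro exI[of _ R] exI[of _ "1 / e"] exI[of _ m]) auto
  next
    assume ?R
    then obtain R C m where R: "0 \<le> R" "0 \<le> C"
      and le: "\<And>f. cmod (T f) \<le> C * Cinf_seminorm (cball 0 R) m f" by blast
    let ?q = "Cinf_seminorm (cball 0 R) m"
    have q: "?q \<in> Cinf_seminorms" unfolding Cinf_seminorms_def using R by force
    have "(T \<longlongrightarrow> T x) (at x)" for x
    proof -
      have "((\<lambda>f. ?q (f - x)) \<longlongrightarrow> 0) (at x)"
        using q Cinf.tendsto_iff_seminorms[of "\<lambda>f. f" x "at x"] by simp
      from tendsto_mult_right_zero[OF this, of C]
      have "((\<lambda>f. T f - T x) \<longlongrightarrow> 0) (at x)"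
      proof (rule Lim_null_comparison[rotated])
        have "T f - T x = T (f - x)" for f
          using add[of "f - x" x] by simp
        then show "\<forall>\<^sub>F f in at x. cmod (T f - T x) \<le> C * ?q (f - x)"
          using le by simp
      qed
      then show ?thesis by (simp add: LIM_zero_iff)
    qed
    then show ?L by (simp add: continuous_on_def)
  }
qed

section \<open>Distributions with compact support\<close>

typedef Cdistr = "{T :: Cinf \<Rightarrow> complex. Vector_Spaces.linear (*\<^sub>C) (*) T \<and> continuous_on UNIV T}"
  morphisms pairing Abs_Cdistr
  by (rule exI[of _ "\<lambda>_. 0"]) (simp add: linear_functional_iff)

setup_lifting type_definition_Cdistr

lemma pairing_linear: "Vector_Spaces.linear (*\<^sub>C) (*) (pairing T)"
  and pairing_continuous: "continuous_on UNIV (pairing T)"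
  using pairing[of T] by auto

lemma pairing_add: "pairing T (f + g) = pairing T f + pairing T g"
  and pairing_scale: "pairing T (c *\<^sub>C f) = c * pairing T f"
  using pairing_linear[of T] unfolding linear_functional_iff by auto

lemma pairing_diff: "pairing T (f - g) = pairing T f - pairing T g"
  using pairing_add[of T "f - g" g] by simp

lemma pairing_bound:
  obtains R C m where "0 \<le> R" "0 \<le> C"
    "\<And>f. cmod (pairing T f) \<le> C * Cinf_seminorm (cball 0 R) m f"
  using pairing_continuous[of T] unfolding continuous_functional_iff[OF pairing_linear] by blast

instantiation Cdistr :: "{ab_group_add, scaleC}"
begin

lift_definition zero_Cdistr :: Cdistr is "\<lambda>_. 0"
  by (simp add: linear_functional_iff)
lift_definition plus_Cdistr :: "Cdistr \<Rightarrow> Cdistr \<Rightarrow> Cdistr" is "\<lambda>S T f. S f + T f"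
  by (auto simp: linear_functional_iff algebra_simps intro!: continuous_intros)
lift_definition uminus_Cdistr :: "Cdistr \<Rightarrow> Cdistr" is "\<lambda>T f. - T f"
  by (auto simp: linear_functional_iff intro!: continuous_intros)
lift_definition minus_Cdistr :: "Cdistr \<Rightarrow> Cdistr \<Rightarrow> Cdistr" is "\<lambda>S T f. S f - T f"
  by (auto simp: linear_functional_iff algebra_simps intro!: continuous_intros)
lift_definition scaleC_Cdistr :: "complex \<Rightarrow> Cdistr \<Rightarrow> Cdistr" is "\<lambda>c T f. c * T f"
  by (auto simp: linear_functional_iff algebra_simps intro!: continuous_intros)

instance
  by standard (transfer; simp add: fun_eq_iff)+

end

text \<open>The strong dual topology: uniform convergence on the bounded subsets of \<^typ>\<open>Cinf\<close>.\<close>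

definition Cdistr_seminorm :: "Cinf set \<Rightarrow> Cdistr \<Rightarrow> real" where
  "Cdistr_seminorm B T = (SUP f\<in>B. cmod (pairing T f))"

definition Cdistr_seminorms :: "(Cdistr \<Rightarrow> real) set" where
  "Cdistr_seminorms = {Cdistr_seminorm B |B. lcs_bounded B \<and> B \<noteq> {}}"

instantiation Cdistr :: topological_space
begin

definition open_Cdistr :: "Cdistr set \<Rightarrow> bool" where
  "open_Cdistr = seminorm_open Cdistr_seminorms"

instance
  by standard (simp_all add: open_Cdistr_def seminorm_open_UNIV seminorm_open_Int seminorm_open_Union)

end

lemma lcs_bounded_singleton: "lcs_bounded {x :: 'a::complex_lcs}"
  unfolding lcs_bounded_def
proof (intro allI impI)
  fix U :: "'a set" assume U: "open U \<and> 0 \<in> U"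
  interpret vector_space "(*\<^sub>C) :: complex \<Rightarrow> 'a \<Rightarrow> 'a" by (rule vector_space_scaleC)
  have "filterlim (\<lambda>d. (d, x)) (nhds 0 \<times>\<^sub>F nhds x) (nhds (0::complex))"
    by (intro filterlim_Pair filterlim_ident tendsto_const)
  from filterlim_compose[OF tendsto_scaleC_Pair this]
  have "((\<lambda>d. d *\<^sub>C x) \<longlongrightarrow> 0) (nhds 0)" by simp
  then have "\<forall>\<^sub>F d in nhds 0. d *\<^sub>C x \<in> U" using U by (auto dest: topological_tendstoD)
  then obtain e where e: "e > 0" "\<And>d. cmod d < e \<Longrightarrow> d *\<^sub>C x \<in> U"
    unfolding eventually_nhds_metric by (auto simp: dist_norm)
  show "\<exists>r>0. \<forall>c. r \<le> cmod c \<longrightarrow> {x} \<subseteq> (\<lambda>x. c *\<^sub>C x) ` U"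
  proof (intro exI[of _ "2 / e"] conjI allI impI)
    fix c :: complex assume c: "2 / e \<le> cmod c"
    then have c0: "c \<noteq> 0" "1 < e * cmod c" using e(1) by (auto simp: field_simps)
    then have "inverse c *\<^sub>C x \<in> U" by (intro e(2)) (simp add: norm_divide field_simps)
    moreover have "x = c *\<^sub>C inverse c *\<^sub>C x" using c0 by (simp add: scaleC_scaleC scaleC_one)
    ultimately show "{x} \<subseteq> (\<lambda>x. c *\<^sub>C x) ` U" by blast
  qed (use e in auto)
qed

lemma pairing_bdd_above:
  assumes "lcs_bounded B"
  shows "bdd_above ((\<lambda>f. cmod (pairing T f)) ` B)"
proof -
  let ?U = "pairing T -` ball 0 1"
  have "pairing T 0 = 0" using pairing_scale[of T 0 0] Cinf.scale_zero_left by simp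
  then have "open ?U \<and> 0 \<in> ?U" using pairing_continuous[of T] by (simp add: open_vimage)
  with assms obtain r where r: "r > 0" "\<And>c. r \<le> cmod c \<Longrightarrow> B \<subseteq> (\<lambda>x. c *\<^sub>C x) ` ?U"
    unfolding lcs_bounded_def by blast
  have "cmod (pairing T f) \<le> r" if "f \<in> B" for f
  proof -
    from r(2)[of "of_real r"] r(1) that obtain g where g: "g \<in> ?U" "f = of_real r *\<^sub>C g" by auto
    then have "cmod (pairing T f) = r * cmod (pairing T g)"
      using r(1) by (simp add: pairing_scale norm_mult)
    also have "\<dots> \<le> r * 1" using g(1) r(1) by (intro mult_left_mono) auto
    finally show ?thesis by simp
  qed
  then show ?thesis by (intro bdd_aboveI2)
qed

lemma Cdistr_seminorm_le_iff:
  assumes "lcs_bounded B" "B \<noteq> {}"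
  shows "Cdistr_seminorm B T \<le> b \<longleftrightarrow> (\<forall>f\<in>B. cmod (pairing T f) \<le> b)"
  unfolding Cdistr_seminorm_def by (rule cSUP_le_iff[OF assms(2) pairing_bdd_above[OF assms(1)]])

lemma Cdistr_seminorm_upper:
  assumes "lcs_bounded B" "f \<in> B"
  shows "cmod (pairing T f) \<le> Cdistr_seminorm B T"
  using Cdistr_seminorm_le_iff[of B T "Cdistr_seminorm B T"] assms by auto

interpretation Cdistr: seminorm_space Cdistr_seminorms
proof
  fix U :: "Cdistr set" show "open U \<longleftrightarrow> seminorm_open Cdistr_seminorms U"
    by (simp add: open_Cdistr_def)
next
  fix p and S T :: Cdistr assume "p \<in> Cdistr_seminorms"
  then obtain B where B: "lcs_bounded B" "B \<noteq> {}" and p: "p = Cdistr_seminorm B"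
    by (auto simp: Cdistr_seminorms_def)
  show "p (S + T) \<le> p S + p T"
    unfolding p Cdistr_seminorm_le_iff[OF B]
    by (auto simp: plus_Cdistr.rep_eq intro!: norm_triangle_le add_mono Cdistr_seminorm_upper B)
next
  fix p c and T :: Cdistr assume "p \<in> Cdistr_seminorms"
  then obtain B where B: "lcs_bounded B" "B \<noteq> {}" and p: "p = Cdistr_seminorm B"
    by (auto simp: Cdistr_seminorms_def)
  have le: "p (c *\<^sub>C T) \<le> cmod c * p T" for c T
    unfolding p Cdistr_seminorm_le_iff[OF B]
    by (auto simp: scaleC_Cdistr.rep_eq norm_mult intro!: mult_left_mono Cdistr_seminorm_upper B)
  have nonneg: "0 \<le> p T" for T
    using B Cdistr_seminorm_upper[OF B(1)] norm_ge_zero order_trans unfolding p by blast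
  show "p (c *\<^sub>C T) = cmod c * p T"
  proof (cases "c = 0")
    case True
    then show ?thesis using le[of c T] nonneg[of "c *\<^sub>C T"] by simp
  next
    case False
    have "inverse c *\<^sub>C c *\<^sub>C T = T"
      using False by transfer (simp add: fun_eq_iff)
    then have "p T \<le> cmod (inverse c) * p (c *\<^sub>C T)"
      using le[of "inverse c" "c *\<^sub>C T"] by simp
    then have "cmod c * p T \<le> p (c *\<^sub>C T)"
      using False by (simp add: norm_divide field_simps)
    with le[of c T] show ?thesis by simp
  qed
next
  fix T :: Cdistr assume *: "\<And>p. p \<in> Cdistr_seminorms \<Longrightarrow> p T = 0"
  have "pairing T f = 0" for f
  proof -
    have "Cdistr_seminorm {f} T = 0"
      by (rule *) (use lcs_bounded_singleton[of f] in \<open>auto simp: Cdistr_seminorms_def\<close>)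
    then show ?thesis using Cdistr_seminorm_upper[OF lcs_bounded_singleton[of f], of f T] by simp
  qed
  then show "T = 0" by transfer auto
qed (transfer; simp add: fun_eq_iff algebra_simps)+

instance Cdistr :: complex_lcs
  by standard (rule Cdistr.tendsto_add_pair Cdistr.tendsto_uminus Cdistr.hausdorff
      Cdistr.scale_add_right Cdistr.scale_add_left Cdistr.scale_scale Cdistr.scale_one
      Cdistr.tendsto_scale_pair Cdistr.convex_nhd; assumption?)+

section \<open>Convolution\<close>

lift_definition reflect :: "Cinf \<Rightarrow> Cinf" is "\<lambda>f y. f (- y)"
  using smooth_affine[of _ 0 "-1"] by simp

lift_definition reflect_at :: "real \<Rightarrow> Cinf \<Rightarrow> Cinf" is "\<lambda>x f y. f (x - y)"
  using smooth_affine[of _ _ "-1"] by simp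

lift_definition Cinf_deriv :: "nat \<Rightarrow> Cinf \<Rightarrow> Cinf" is "\<lambda>n f. (vderiv ^^ n) f"
  by (rule smooth_vderiv)

lemma vderiv_Cinf_deriv:
  "(vderiv ^^ i) (Cinf_fun (Cinf_deriv n f)) = (vderiv ^^ (i + n)) (Cinf_fun f)"
  by (simp add: Cinf_deriv.rep_eq funpow_add)

lemma Cinf_deriv_Cinf_deriv: "Cinf_deriv k (Cinf_deriv n f) = Cinf_deriv (k + n) f"
  by (simp add: Cinf_fun_inject[symmetric] Cinf_deriv.rep_eq funpow_add)

lemma vderiv_reflect_at:
  "(vderiv ^^ i) (Cinf_fun (reflect_at x f)) y = of_real ((-1) ^ i) * (vderiv ^^ i) (Cinf_fun f) (x - y)"
  using vderiv_affine[OF smooth_Cinf_fun, of i f x "-1"] by (simp add: reflect_at.rep_eq)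

lemma reflect_eq: "reflect f = reflect_at 0 f"
  by transfer simp

lemma vderiv_Cinf_minus:
  "(vderiv ^^ i) (Cinf_fun (f - g)) y = (vderiv ^^ i) (Cinf_fun f) y - (vderiv ^^ i) (Cinf_fun g) y"
proof -
  have "f - g = f + (-1) *\<^sub>C g" by transfer simp
  then show ?thesis
    by (simp only: plus_Cinf.rep_eq scaleC_Cinf.rep_eq vderiv_add vderiv_scale smooth_Cinf_fun
        smooth_scale) simp
qed

lemma vderiv_Cinf_scale:
  "(vderiv ^^ i) (Cinf_fun (c *\<^sub>C f)) y = c * (vderiv ^^ i) (Cinf_fun f) y"
  by (simp add: scaleC_Cinf.rep_eq vderiv_scale smooth_Cinf_fun)

lemma Cinf_seminorm_reflect_at:
  assumes "0 \<le> R" "0 \<le> Q" "\<bar>x\<bar> \<le> Q"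
  shows "Cinf_seminorm (cball 0 R) m (reflect_at x (Cinf_deriv k f)) \<le>
    Cinf_seminorm (cball 0 (Q + R)) (m + k) f"
  using assms
  by (auto simp: Cinf_seminorm_le_iff vderiv_reflect_at vderiv_Cinf_deriv norm_mult norm_power
      dist_norm intro!: Cinf_seminorm_upper)

lemma taylor_bound:
  assumes f: "smooth f" and M: "\<And>s. \<bar>s\<bar> \<le> r \<Longrightarrow> cmod ((vderiv ^^ (n + 2)) f s) \<le> M"
    and a: "\<bar>a\<bar> \<le> r" and b: "\<bar>a + h\<bar> \<le> r"
  shows "cmod ((vderiv ^^ n) f (a + h) - (vderiv ^^ n) f a - of_real h * (vderiv ^^ Suc n) f a) \<le> M * h\<^sup>2"
proof -
  let ?S = "closed_segment a (a + h)"
  have S: "\<bar>s\<bar> \<le> r" "\<bar>s - a\<bar> \<le> \<bar>h\<bar>" if "s \<in> ?S" for s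
    using that a b by (auto simp: closed_segment_eq_real_ivl split: if_splits)
  have d: "((vderiv ^^ k) f has_vector_derivative (vderiv ^^ Suc k) f s) (at s within X)" for k s X
    by (rule has_vector_derivative_at_within[OF smoothD[OF f]])
  have M0: "0 \<le> M" using M[OF a] norm_ge_zero order_trans by blast
  have B: "cmod ((vderiv ^^ Suc n) f s - (vderiv ^^ Suc n) f a) \<le> M * \<bar>h\<bar>" if s: "s \<in> ?S" for s
  proof -
    have "cmod ((vderiv ^^ Suc n) f s - (vderiv ^^ Suc n) f a) \<le> M * norm (s - a)"
    proof (rule differentiable_bound[where S = ?S and f' = "\<lambda>x h. h *\<^sub>R (vderiv ^^ (n + 2)) f x"])
      show "((vderiv ^^ Suc n) f has_derivative (\<lambda>h. h *\<^sub>R (vderiv ^^ (n + 2)) f x)) (at x within ?S)" for x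
        using d[of "Suc n"] by (simp add: has_vector_derivative_def)
      show "onorm (\<lambda>h. h *\<^sub>R (vderiv ^^ (n + 2)) f x) \<le> M" if "x \<in> ?S" for x
        using M[OF S(1)[OF that]]
        by (intro onorm_le) (simp add: mult.commute[of M] mult_left_mono del: funpow.simps)
    qed (use s in auto)
    also have "\<dots> \<le> M * \<bar>h\<bar>" using S[OF s] M0 by (simp add: mult_left_mono)
    finally show ?thesis .
  qed
  have "cmod ((vderiv ^^ n) f (a + h) - (vderiv ^^ n) f a - (a + h - a) *\<^sub>R (vderiv ^^ Suc n) f a)
      \<le> norm (a + h - a) * (M * \<bar>h\<bar>)"
    by (rule vector_differentiable_bound_linearization[of ?S _ "(vderiv ^^ Suc n) f"])
      (use B d in \<open>simp_all del: funpow.simps\<close>)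
  then show ?thesis by (simp add: scaleR_conv_of_real power2_eq_square mult_ac del: funpow.simps)
qed

lemma pairing_reflect_at_deriv:
  "((\<lambda>x. pairing T (reflect_at x f)) has_vector_derivative
    pairing T (reflect_at x (Cinf_deriv 1 f))) (at x)"
proof -
  obtain R C m where R: "0 \<le> R" "0 \<le> C"
    and le: "\<And>f. cmod (pairing T f) \<le> C * Cinf_seminorm (cball 0 R) m f"
    by (rule pairing_bound[of T]) blast
  define r where "r = \<bar>x\<bar> + 1 + R"
  have "compact (cball (0::real) r)" by simp
  then obtain M0 where M0: "\<And>x i. x \<in> cball 0 r \<Longrightarrow> i \<le> m + 2 \<Longrightarrow>
      cmod ((vderiv ^^ i) (Cinf_fun f) x) \<le> M0"
    using vderiv_bounded[of "cball 0 r" "m + 2" f] by metis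
  define M where "M = max 0 M0"
  have M: "0 \<le> M" "\<And>s i. \<bar>s\<bar> \<le> r \<Longrightarrow> i \<le> m + 2 \<Longrightarrow> cmod ((vderiv ^^ i) (Cinf_fun f) s) \<le> M"
    using M0 by (auto simp: M_def le_max_iff_disj)
  define D where "D = pairing T (reflect_at x (Cinf_deriv 1 f))"
  have main: "cmod (pairing T (reflect_at (x + h) f) - pairing T (reflect_at x f) - of_real h * D) \<le>
      C * M * h\<^sup>2" if h: "\<bar>h\<bar> < 1" for h
  proof -
    define g where "g = reflect_at (x + h) f - reflect_at x f - of_real h *\<^sub>C reflect_at x (Cinf_deriv 1 f)"
    have "Cinf_seminorm (cball 0 R) m g \<le> M * h\<^sup>2"
    proof -
      have "cmod ((vderiv ^^ i) (Cinf_fun g) y) \<le> M * h\<^sup>2" if y: "\<bar>y\<bar> \<le> R" and i: "i \<le> m" for y i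
      proof -
        let ?v = "\<lambda>i. (vderiv ^^ i) (Cinf_fun f)"
        have "(vderiv ^^ i) (Cinf_fun g) y =
            of_real ((-1) ^ i) * (?v i (x - y + h) - ?v i (x - y) - of_real h * ?v (Suc i) (x - y))"
          unfolding g_def vderiv_Cinf_minus vderiv_Cinf_scale vderiv_reflect_at vderiv_Cinf_deriv
          by (simp add: algebra_simps del: funpow.simps)
        then have "cmod ((vderiv ^^ i) (Cinf_fun g) y) =
            cmod (?v i (x - y + h) - ?v i (x - y) - of_real h * ?v (Suc i) (x - y))"
          by (simp add: norm_mult norm_power del: funpow.simps)
        also have "\<dots> \<le> M * h\<^sup>2"
          using y h R i by (intro taylor_bound[where r = r] smooth_Cinf_fun M) (auto simp: r_def)
        finally show ?thesis .
      qed
      then show ?thesis using R by (subst Cinf_seminorm_le_iff) auto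
    qed
    then have "cmod (pairing T g) \<le> C * (M * h\<^sup>2)"
      using le[of g] R by (meson mult_left_mono order_trans)
    then show ?thesis by (simp add: g_def pairing_diff pairing_scale D_def mult_ac)
  qed
  show ?thesis
    unfolding has_vector_derivative_def has_derivative_at_alt D_def[symmetric]
  proof (intro conjI allI impI)
    show "bounded_linear (\<lambda>h. h *\<^sub>R D)" by (rule bounded_linear_scaleR_left)
    fix e :: real assume e: "0 < e"
    define d where "d = min 1 (e / (C * M + 1))"
    have CM: "0 \<le> C * M" using R M by simp
    have d: "d > 0" using e CM by (simp add: d_def)
    have "cmod (pairing T (reflect_at y f) - pairing T (reflect_at x f) - (y - x) *\<^sub>R D) \<le> e * norm (y - x)"
      if y: "norm (y - x) < d" for y
    proof -
      have "\<bar>y - x\<bar> < 1" "\<bar>y - x\<bar> < e / (C * M + 1)" using y by (auto simp: d_def)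
      then have h: "\<bar>y - x\<bar> < 1" "C * M * \<bar>y - x\<bar> \<le> e"
        using CM by (auto simp: field_simps)
      have "cmod (pairing T (reflect_at y f) - pairing T (reflect_at x f) - (y - x) *\<^sub>R D) \<le>
          C * M * (y - x)\<^sup>2"
        using main[OF h(1)] by (simp add: scaleR_conv_of_real)
      also have "\<dots> = (C * M * \<bar>y - x\<bar>) * \<bar>y - x\<bar>"
        by (simp add: power2_eq_square mult_ac)
      also have "\<dots> \<le> e * \<bar>y - x\<bar>" using h(2) by (intro mult_right_mono) auto
      finally show ?thesis by simp
    qed
    then show "\<exists>d>0. \<forall>y. norm (y - x) < d \<longrightarrow>
        cmod (pairing T (reflect_at y f) - pairing T (reflect_at x f) - (y - x) *\<^sub>R D) \<le> e * norm (y - x)"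
      using d by blast
  qed
qed

lemma
  shows smooth_pairing_reflect_at: "smooth (\<lambda>x. pairing T (reflect_at x f))"
    and vderiv_pairing_reflect_at: "(vderiv ^^ n) (\<lambda>x. pairing T (reflect_at x f)) =
      (\<lambda>x. pairing T (reflect_at x (Cinf_deriv n f)))"
proof -
  let ?g = "\<lambda>n x. pairing T (reflect_at x (Cinf_deriv n f))"
  have 0: "Cinf_deriv 0 f = f" by transfer simp
  have *: "(?g n has_vector_derivative ?g (Suc n) x) (at x)" for n x
    using pairing_reflect_at_deriv[of T "Cinf_deriv n f" x] by (simp add: Cinf_deriv_Cinf_deriv)
  show "smooth (\<lambda>x. pairing T (reflect_at x f))"
    using smoothI[of ?g, OF *] by (simp add: 0)
  show "(vderiv ^^ n) (\<lambda>x. pairing T (reflect_at x f)) = ?g n"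
    using vderiv_chain[of ?g n, OF *] by (simp add: 0)
qed

lift_definition conv_fun :: "Cdistr \<Rightarrow> Cinf \<Rightarrow> Cinf"  (infixr \<open>\<star>\<^sub>f\<close> 75)
  is "\<lambda>T f x. pairing T (reflect_at x f)"
  by (rule smooth_pairing_reflect_at)

lift_definition reflect_Cdistr :: "Cdistr \<Rightarrow> Cdistr" is "\<lambda>T f. T (reflect f)"
proof -
  fix T :: "Cinf \<Rightarrow> complex"
  assume T: "Vector_Spaces.linear (*\<^sub>C) (*) T \<and> continuous_on UNIV T"
  have "reflect (f + g) = reflect f + reflect g" "reflect (c *\<^sub>C f) = c *\<^sub>C reflect f" for f g c
    by (transfer; simp)+
  then have lin: "Vector_Spaces.linear (*\<^sub>C) (*) (\<lambda>f. T (reflect f))"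
    using T by (simp add: linear_functional_iff)
  from T obtain R C m where R: "0 \<le> R" "0 \<le> C"
    and le: "\<And>f. cmod (T f) \<le> C * Cinf_seminorm (cball 0 R) m f"
    using continuous_functional_iff by blast
  have "cmod (T (reflect f)) \<le> C * Cinf_seminorm (cball 0 R) m f" for f
  proof -
    have "Cinf_deriv 0 f = f" by transfer simp
    then have "Cinf_seminorm (cball 0 R) m (reflect f) \<le> Cinf_seminorm (cball 0 R) m f"
      using Cinf_seminorm_reflect_at[of R 0 0 m 0 f] R by (simp add: reflect_eq)
    then show ?thesis using le[of "reflect f"] R by (meson mult_left_mono order_trans)
  qed
  then show "Vector_Spaces.linear (*\<^sub>C) (*) (\<lambda>f. T (reflect f)) \<and> continuous_on UNIV (\<lambda>f. T (reflect f))"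
    using lin R unfolding continuous_functional_iff[OF lin] by blast
qed

lift_definition conv :: "Cdistr \<Rightarrow> Cdistr \<Rightarrow> Cdistr"  (infixr \<open>\<star>\<close> 75)
  is "\<lambda>T S f. pairing S (reflect_Cdistr T \<star>\<^sub>f f)"
proof -
  fix T S :: Cdistr
  let ?T = "reflect_Cdistr T"
  have refl: "reflect_at x (f + g) = reflect_at x f + reflect_at x g"
    "reflect_at x (c *\<^sub>C f) = c *\<^sub>C reflect_at x f" for x f g c
    by (transfer; simp)+
  have "?T \<star>\<^sub>f (f + g) = ?T \<star>\<^sub>f f + ?T \<star>\<^sub>f g" "?T \<star>\<^sub>f (c *\<^sub>C f) = c *\<^sub>C (?T \<star>\<^sub>f f)" for f g c
    by (simp_all add: Cinf_fun_inject[symmetric] conv_fun.rep_eq plus_Cinf.rep_eq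
        scaleC_Cinf.rep_eq refl pairing_add pairing_scale)
  then have lin: "Vector_Spaces.linear (*\<^sub>C) (*) (\<lambda>f. pairing S (?T \<star>\<^sub>f f))"
    by (simp add: linear_functional_iff pairing_add pairing_scale)
  obtain R C m where R: "0 \<le> R" "0 \<le> C"
    and leT: "\<And>f. cmod (pairing ?T f) \<le> C * Cinf_seminorm (cball 0 R) m f"
    by (rule pairing_bound[of ?T]) blast
  obtain Q D k where Q: "0 \<le> Q" "0 \<le> D"
    and leS: "\<And>f. cmod (pairing S f) \<le> D * Cinf_seminorm (cball 0 Q) k f"
    by (rule pairing_bound[of S]) blast
  let ?q = "Cinf_seminorm (cball 0 (Q + R)) (m + k)"
  have "cmod (pairing S (?T \<star>\<^sub>f f)) \<le> (D * C) * ?q f" for f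
  proof -
    have "cmod ((vderiv ^^ i) (Cinf_fun (?T \<star>\<^sub>f f)) x) \<le> C * ?q f" if "\<bar>x\<bar> \<le> Q" "i \<le> k" for x i
    proof -
      have "cmod ((vderiv ^^ i) (Cinf_fun (?T \<star>\<^sub>f f)) x) \<le>
          C * Cinf_seminorm (cball 0 R) m (reflect_at x (Cinf_deriv i f))"
        by (simp add: conv_fun.rep_eq vderiv_pairing_reflect_at leT)
      also have "\<dots> \<le> C * Cinf_seminorm (cball 0 (Q + R)) (m + i) f"
        using R Q that by (intro mult_left_mono Cinf_seminorm_reflect_at) auto
      also have "\<dots> \<le> C * ?q f"
        using R Q that
        by (intro mult_left_mono) (auto simp: Cinf_seminorm_le_iff intro!: Cinf_seminorm_upper)
      finally show ?thesis .
    qed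
    then have "Cinf_seminorm (cball 0 Q) k (?T \<star>\<^sub>f f) \<le> C * ?q f"
      using Q by (subst Cinf_seminorm_le_iff) auto
    then have "D * Cinf_seminorm (cball 0 Q) k (?T \<star>\<^sub>f f) \<le> D * (C * ?q f)"
      using Q by (intro mult_left_mono)
    then show ?thesis using leS[of "?T \<star>\<^sub>f f"] by (simp add: mult_ac)
  qed
  then show "Vector_Spaces.linear (*\<^sub>C) (*) (\<lambda>f. pairing S (?T \<star>\<^sub>f f)) \<and>
      continuous_on UNIV (\<lambda>f. pairing S (?T \<star>\<^sub>f f))"
    using lin R Q unfolding continuous_functional_iff[OF lin]
    by (intro conjI exI[of _ "Q + R"] exI[of _ "D * C"] exI[of _ "m + k"]) auto
qed

text \<open>The powers are indexed from \<^term>\<open>1::nat\<close>; the value at \<^term>\<open>0::nat\<close> is never used.\<close>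

fun conv_power :: "Cdistr \<Rightarrow> nat \<Rightarrow> Cdistr" where
  "conv_power T 0 = 0"
| "conv_power T (Suc 0) = T"
| "conv_power T (Suc (Suc n)) = T \<star> conv_power T (Suc n)"

definition conv_mean :: "Cdistr \<Rightarrow> nat \<Rightarrow> Cdistr" where
  "conv_mean T n = (1 / of_nat n) *\<^sub>C (\<Sum>m = 1..n. conv_power T m)"

end

theory Submission
  imports Defs
begin

text \<open>
  Convolution is associative with unit the Dirac distribution \<open>\<delta>\<close>, so the powers and Cesaro means
  of \<open>\<C>\<^sub>T\<close> are the convolution operators with symbols \<open>(\<star>T)\<^sup>n\<close> and \<open>(\<star>T)\<^bsub>[n]\<^esub>\<close>, and evaluating at
  \<open>\<delta>\<close> gives the forward implications. Conversely, the derivative of order \<open>i\<close> at \<open>x\<close> of the function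
  paired with \<open>S\<close> in \<open>\<langle>T \<star> S, f\<rangle>\<close> is \<open>\<langle>T\<^sub>y, f\<^sup>(\<^sup>i\<^sup>)(x + y)\<rangle>\<close>, and the functions
  \<open>f\<^sup>(\<^sup>i\<^sup>)(x + \<cdot>)\<close> form a bounded set when \<open>f\<close> runs through a bounded set, \<open>x\<close> through a compact set and
  \<open>i \<le> k\<close>. Hence convolution with a bounded set of symbols is equicontinuous, and \<open>T \<star> S\<close> depends
  continuously on \<open>T\<close> for the strong topology.
\<close>

section \<open>Seminorms, boundedness and linear operators\<close>

text \<open>Absorption by the unit ball of one seminorm is a bound for that seminorm on
  \<open>B\<close>. Conversely, a neighbourhood of 0 is controlled by finitely many seminorms, whose
  bounds have a common maximum.\<close>

lemma lcs_bounded_iff_seminorms: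
  fixes P :: "('a::complex_lcs \<Rightarrow> real) set"
  assumes "seminorm_space P"
  shows "lcs_bounded B \<longleftrightarrow> (\<forall>p\<in>P. \<exists>M. \<forall>x\<in>B. p x \<le> M)"
proof
  interpret seminorm_space P by fact
  assume B: "lcs_bounded B"
  show "\<forall>p\<in>P. \<exists>M. \<forall>x\<in>B. p x \<le> M"
  proof
    fix p assume p: "p \<in> P"
    let ?U = "{y. \<forall>q\<in>{p}. q (y - 0) < 1}"
    have "open ?U \<and> 0 \<in> ?U" using p mem_ball[of "{p}" 1 0] open_ball[of "{p}" 0 1] by auto
    with B obtain r where r: "r > 0" "\<And>c. r \<le> cmod c \<Longrightarrow> B \<subseteq> (\<lambda>x. c *\<^sub>C x) ` ?U"
      unfolding lcs_bounded_def by meson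
    have "p x \<le> r" if "x \<in> B" for x
    proof -
      from r(2)[of "of_real r"] r(1) that obtain y where y: "p y < 1" "x = of_real r *\<^sub>C y" by auto
      then show ?thesis using r(1) homogeneous[OF p, of "of_real r" y] by (simp add: mult_left_le)
    qed
    then show "\<exists>M. \<forall>x\<in>B. p x \<le> M" by blast
  qed
next
  interpret seminorm_space P by fact
  assume bd: "\<forall>p\<in>P. \<exists>M. \<forall>x\<in>B. p x \<le> M"
  then obtain M where M: "\<And>p x. p \<in> P \<Longrightarrow> x \<in> B \<Longrightarrow> p x \<le> M p" by metis
  show "lcs_bounded B"
    unfolding lcs_bounded_def
  proof (intro allI impI)
    fix U :: "'a set" assume "open U \<and> 0 \<in> U"
    then obtain F e where F: "finite F" "F \<subseteq> P" "0 < e"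
      and U: "\<And>y. (\<And>p. p \<in> F \<Longrightarrow> p (y - 0) < e) \<Longrightarrow> y \<in> U"
      using open_nhd[of U 0] by blast
    \<comment> \<open>Inserting 0 covers an empty \<open>F\<close> and makes \<open>N\<close>
      nonnegative; the 1 in \<open>r\<close> gives the strict inequality
      \<open>p x < e * r\<close>.\<close>
    define N where "N = Max (insert 0 (M ` F))"
    have N: "0 \<le> N" "\<And>p. p \<in> F \<Longrightarrow> M p \<le> N" using F(1) by (auto simp: N_def)
    define r where "r = (N + 1) / e"
    have "r > 0" using N(1) F(3) by (simp add: r_def)
    moreover have "B \<subseteq> (\<lambda>x. c *\<^sub>C x) ` U" if c: "r \<le> cmod c" for c
    proof
      fix x assume x: "x \<in> B"
      have c0: "c \<noteq> 0" using c \<open>r > 0\<close> by auto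
      have "inverse c *\<^sub>C x \<in> U"
      proof (rule U)
        fix p assume p: "p \<in> F"
        have "p x < e * r" using M[of p x] N(2)[OF p] F p x by (auto simp: r_def)
        also have "\<dots> \<le> e * cmod c" using c F(3) by simp
        finally have "p x < e * cmod c" .
        moreover have "p (inverse c *\<^sub>C x) = p x / cmod c"
          using homogeneous[of p "inverse c" x] F p by (auto simp: norm_inverse divide_inverse_commute)
        ultimately show "p (inverse c *\<^sub>C x - 0) < e"
          using c0 by (simp add: pos_divide_less_eq)
      qed
      moreover have "x = c *\<^sub>C inverse c *\<^sub>C x" using c0 by (simp add: scale_scale scale_one)
      ultimately show "x \<in> (\<lambda>x. c *\<^sub>C x) ` U" by blast
    qed
    ultimately show "\<exists>r>0. \<forall>c. r \<le> cmod c \<longrightarrow> B \<subseteq> (\<lambda>x. c *\<^sub>C x) ` U" by blast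
  qed
qed

lemma lcs_bounded_Cinf_iff:
  "lcs_bounded B \<longleftrightarrow>
    (\<forall>R m. \<exists>M. \<forall>f\<in>B. \<forall>x\<in>cball 0 R. \<forall>i\<le>m. cmod ((vderiv ^^ i) (Cinf_fun f) x) \<le> M)"
  (is "_ \<longleftrightarrow> ?R")
  unfolding lcs_bounded_iff_seminorms[OF Cinf.seminorm_space_axioms]
proof (intro iffI allI ballI)
  fix R :: real and m
  assume bd: "\<forall>p\<in>Cinf_seminorms. \<exists>M. \<forall>f\<in>B. p f \<le> M"
  show "\<exists>M. \<forall>f\<in>B. \<forall>x\<in>cball 0 R. \<forall>i\<le>m. cmod ((vderiv ^^ i) (Cinf_fun f) x) \<le> M"
  proof (cases "cball (0::real) R = {}")
    \<comment> \<open>For negative \<open>R\<close> the ball is empty and yields no member of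
      \<open>Cinf_seminorms\<close>, but the bound is vacuous.\<close>
    case True
    show ?thesis unfolding True by simp
  next
    case False
    have "Cinf_seminorm (cball 0 R) m \<in> Cinf_seminorms"
      unfolding Cinf_seminorms_def using compact_cball False by blast
    with bd obtain M where "\<forall>f\<in>B. Cinf_seminorm (cball 0 R) m f \<le> M" by blast
    then show ?thesis
      unfolding Cinf_seminorm_le_iff[OF compact_cball False] ..
  qed
next
  fix p assume bd: ?R and "p \<in> Cinf_seminorms"
  then obtain K m where K: "compact K" "K \<noteq> {}" and p: "p = Cinf_seminorm K m"
    by (auto simp: Cinf_seminorms_def)
  obtain R where R: "K \<subseteq> cball 0 R"
    using bounded_subset_ballD[OF compact_imp_bounded[OF K(1)], of 0] ball_subset_cball by blast
  from bd obtain M where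
    "\<forall>f\<in>B. \<forall>x\<in>cball 0 R. \<forall>i\<le>m. cmod ((vderiv ^^ i) (Cinf_fun f) x) \<le> M" by blast
  then show "\<exists>M. \<forall>f\<in>B. p f \<le> M"
    using R unfolding p Cinf_seminorm_le_iff[OF K] by blast
qed

lemma lcs_bounded_Cdistr_iff:
  "lcs_bounded \<T> \<longleftrightarrow> (\<forall>B. lcs_bounded B \<longrightarrow> (\<exists>M. \<forall>T\<in>\<T>. \<forall>f\<in>B. cmod (pairing T f) \<le> M))"
  (is "_ \<longleftrightarrow> ?R")
proof -
  have "lcs_bounded \<T> \<longleftrightarrow>
      (\<forall>B. lcs_bounded B \<and> B \<noteq> {} \<longrightarrow> (\<exists>M. \<forall>T\<in>\<T>. Cdistr_seminorm B T \<le> M))"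
    unfolding lcs_bounded_iff_seminorms[OF Cdistr.seminorm_space_axioms] Cdistr_seminorms_def
    by blast
  also have "\<dots> \<longleftrightarrow> ?R"
  proof (intro iff_allI)
    fix B show "(lcs_bounded B \<and> B \<noteq> {} \<longrightarrow> (\<exists>M. \<forall>T\<in>\<T>. Cdistr_seminorm B T \<le> M)) \<longleftrightarrow>
        (lcs_bounded B \<longrightarrow> (\<exists>M. \<forall>T\<in>\<T>. \<forall>f\<in>B. cmod (pairing T f) \<le> M))"
      by (cases "B = {}") (auto simp: Cdistr_seminorm_le_iff)
  qed
  finally show ?thesis .
qed

lemma linear_operator_iff:
  fixes A :: "'a::complex_lcs \<Rightarrow> 'a"
  shows "Vector_Spaces.linear (*\<^sub>C) (*\<^sub>C) A \<longleftrightarrow>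
    (\<forall>x y. A (x + y) = A x + A y) \<and> (\<forall>c x. A (c *\<^sub>C x) = c *\<^sub>C A x)"
  by (simp add: module_hom_iff_linear[symmetric] module_hom_def module_hom_axioms_def
      module_iff_vector_space vector_space_scaleC)

text \<open>A neighbourhood \<open>U\<close> that every member of \<open>H\<close> maps into
  \<open>V\<close> absorbs the point \<open>x\<close>; by linearity \<open>V\<close> then absorbs
  the orbit with the same radius.\<close>

lemma equicontinuous_imp_orbit_bounded:
  assumes "equicontinuous H"
  shows "lcs_bounded {A x |A. A \<in> H}"
  unfolding lcs_bounded_def
proof (intro allI impI)
  fix V :: "'a set" assume "open V \<and> 0 \<in> V"
  with assms obtain U where U: "open U" "0 \<in> U" "\<And>A. A \<in> H \<Longrightarrow> A ` U \<subseteq> V"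
    unfolding equicontinuous_def by meson
  obtain r where r: "r > 0" "\<And>c. r \<le> cmod c \<Longrightarrow> {x} \<subseteq> (\<lambda>x. c *\<^sub>C x) ` U"
    using lcs_bounded_singleton[of x, unfolded lcs_bounded_def, rule_format, OF conjI, OF U(1,2)]
    by blast
  have "{A x |A. A \<in> H} \<subseteq> (\<lambda>x. c *\<^sub>C x) ` V" if "r \<le> cmod c" for c
  proof safe
    fix A assume A: "A \<in> H"
    from r(2)[OF that] obtain u where u: "u \<in> U" "x = c *\<^sub>C u" by blast
    have "Vector_Spaces.linear (*\<^sub>C) (*\<^sub>C) A"
      using assms A by (auto simp: equicontinuous_def continuous_linear_operators_def)
    then have "A x = c *\<^sub>C A u" by (simp add: u(2) linear_operator_iff)
    then show "A x \<in> (\<lambda>x. c *\<^sub>C x) ` V" using U(3)[OF A] u(1) by blast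
  qed
  then show "\<exists>r>0. \<forall>c. r \<le> cmod c \<longrightarrow> {A x |A. A \<in> H} \<subseteq> (\<lambda>x. c *\<^sub>C x) ` V"
    using r(1) by blast
qed

section \<open>Algebra of convolution\<close>

lift_definition translate :: "real \<Rightarrow> Cinf \<Rightarrow> Cinf" is "\<lambda>x f y. f (x + y)"
  using smooth_affine[of _ _ 1] by simp

lemma reflect_reflect_at: "reflect (reflect_at x f) = translate x f"
  by transfer simp

lemma vderiv_translate:
  "(vderiv ^^ i) (Cinf_fun (translate x f)) y = (vderiv ^^ i) (Cinf_fun f) (x + y)"
  using vderiv_affine[OF smooth_Cinf_fun, of i f x 1] by (simp add: translate.rep_eq)

text \<open>The two reflections cancel, so this is the function x -> <T_y, f(x + y)>. The map
  \<open>conv_test T\<close> is the transpose of convolution with \<open>T\<close>.\<close>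

definition conv_test :: "Cdistr \<Rightarrow> Cinf \<Rightarrow> Cinf" where
  "conv_test T f = reflect_Cdistr T \<star>\<^sub>f f"

lemma pairing_conv: "pairing (T \<star> S) f = pairing S (conv_test T f)"
  by (simp add: conv.rep_eq conv_test_def)

text \<open>Derivatives fall on \<open>f\<close>, so seminorms of \<open>conv_test T f\<close> are
  suprema of values of \<open>T\<close> on translated derivatives of \<open>f\<close>. Both
  continuity estimates below rest on this.\<close>

lemma vderiv_conv_test:
  "(vderiv ^^ i) (Cinf_fun (conv_test T f)) x = pairing T (translate x (Cinf_deriv i f))"
  unfolding conv_test_def conv_fun.rep_eq vderiv_pairing_reflect_at
  by (simp add: reflect_Cdistr.rep_eq reflect_reflect_at)

lemma Cinf_fun_conv_test: "Cinf_fun (conv_test T f) x = pairing T (translate x f)"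
  by (simp add: conv_test_def conv_fun.rep_eq reflect_Cdistr.rep_eq reflect_reflect_at)

lemma Cinf_eqI: "(\<And>x. Cinf_fun f x = Cinf_fun g x) \<Longrightarrow> f = g"
  by (simp add: Cinf_fun_inject[symmetric] fun_eq_iff)

lemma Cdistr_eqI: "(\<And>f. pairing S f = pairing T f) \<Longrightarrow> S = T"
  by (simp add: pairing_inject[symmetric] fun_eq_iff)

lemma translate_conv_test: "translate x (conv_test T f) = conv_test T (translate x f)"
proof (rule Cinf_eqI)
  have "translate (x + y) f = translate y (translate x f)" for y
    by transfer (simp add: add_ac)
  then show "Cinf_fun (translate x (conv_test T f)) y = Cinf_fun (conv_test T (translate x f)) y"
    for y by (simp add: translate.rep_eq Cinf_fun_conv_test)
qed

text \<open>Since \<open>conv_test T\<close> commutes with translations, it can be moved past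
  \<open>translate x\<close>. Transposing this identity gives associativity.\<close>

lemma conv_test_conv: "conv_test (T \<star> R) f = conv_test R (conv_test T f)"
  by (rule Cinf_eqI) (simp add: Cinf_fun_conv_test pairing_conv translate_conv_test)

lemma conv_assoc: "(T \<star> R) \<star> S = T \<star> (R \<star> S)"
  by (rule Cdistr_eqI) (simp add: pairing_conv conv_test_conv)

lemma conv_test_add: "conv_test (T + R) f = conv_test T f + conv_test R f"
  by (rule Cinf_eqI) (simp add: Cinf_fun_conv_test plus_Cinf.rep_eq plus_Cdistr.rep_eq)

lemma conv_test_scale: "conv_test (c *\<^sub>C T) f = c *\<^sub>C conv_test T f"
  by (rule Cinf_eqI) (simp add: Cinf_fun_conv_test scaleC_Cinf.rep_eq scaleC_Cdistr.rep_eq)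

lemma conv_add_left: "(T + R) \<star> S = T \<star> S + R \<star> S"
  by (rule Cdistr_eqI) (simp add: pairing_conv conv_test_add pairing_add plus_Cdistr.rep_eq)

lemma conv_scale_left: "(c *\<^sub>C T) \<star> S = c *\<^sub>C (T \<star> S)"
  by (rule Cdistr_eqI) (simp add: pairing_conv conv_test_scale pairing_scale scaleC_Cdistr.rep_eq)

lemma conv_add_right: "T \<star> (S + R) = T \<star> S + T \<star> R"
  by (rule Cdistr_eqI) (simp add: pairing_conv plus_Cdistr.rep_eq)

lemma conv_scale_right: "T \<star> (c *\<^sub>C S) = c *\<^sub>C (T \<star> S)"
  by (rule Cdistr_eqI) (simp add: pairing_conv scaleC_Cdistr.rep_eq)

lemma conv_zero_left: "0 \<star> S = 0"
  using conv_add_left[of 0 0 S] by simp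

lemma conv_diff_left: "(T - R) \<star> S = T \<star> S - R \<star> S"
  using conv_add_left[of "T - R" R S] by simp

lemma conv_sum_left: "(\<Sum>m\<in>I. T m) \<star> S = (\<Sum>m\<in>I. T m \<star> S)"
  by (induction I rule: infinite_finite_induct) (simp_all add: conv_zero_left conv_add_left)

section \<open>The Dirac distribution, powers and Cesaro means\<close>

lift_definition dirac :: Cdistr is "\<lambda>f. Cinf_fun f 0"
proof -
  have lin: "Vector_Spaces.linear (*\<^sub>C) (*) (\<lambda>f. Cinf_fun f 0)"
    by (simp add: linear_functional_iff plus_Cinf.rep_eq scaleC_Cinf.rep_eq)
  have "cmod (Cinf_fun f 0) \<le> 1 * Cinf_seminorm (cball 0 0) 0 f" for f
    using Cinf_seminorm_upper[of "cball 0 0" 0 0 0 f] by simp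
  then show "Vector_Spaces.linear (*\<^sub>C) (*) (\<lambda>f. Cinf_fun f 0) \<and>
      continuous_on UNIV (\<lambda>f. Cinf_fun f 0)"
    using lin unfolding continuous_functional_iff[OF lin]
    by (intro conjI exI[of _ 0] exI[of _ 1] exI[of _ "0::nat"]) auto
qed

text \<open>Evaluating \<open>conv_test T f\<close> at 0 gives <T, f>. Thus a convolution operator
  returns its symbol at \<open>dirac\<close>.\<close>

lemma conv_dirac: "T \<star> dirac = T"
proof (rule Cdistr_eqI)
  fix f
  have "translate 0 f = f" by transfer simp
  then show "pairing (T \<star> dirac) f = pairing T f"
    by (simp add: pairing_conv dirac.rep_eq Cinf_fun_conv_test)
qed

text \<open>Induction by associativity, started at 1 because \<open>conv_power T 0\<close> is 0
  while the zeroth iterate is the identity.\<close>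

lemma funpow_conv:
  assumes "1 \<le> n" shows "((\<lambda>S. T \<star> S) ^^ n) S = conv_power T n \<star> S"
  using assms
proof (induction n rule: nat_induct_at_least)
  case (Suc n)
  then show ?case by (cases n) (simp_all add: conv_assoc)
qed simp

lemma cesaro_mean_conv: "cesaro_mean (\<lambda>S. T \<star> S) n S = conv_mean T n \<star> S"
  by (simp add: cesaro_mean_def conv_mean_def conv_scale_left conv_sum_left funpow_conv)

section \<open>Continuity of convolution\<close>

lemma lcs_bounded_translates:
  assumes "lcs_bounded B"
  shows "lcs_bounded {translate x (Cinf_deriv i f) |x i f. x \<in> cball 0 Q \<and> i \<le> k \<and> f \<in> B}"
    (is "lcs_bounded ?B'")
  unfolding lcs_bounded_Cinf_iff
proof (intro allI)
  fix R m
  \<comment> \<open>Translation by at most \<open>Q\<close> enlarges the radius to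
    \<open>Q + R\<close>; the derivative orders \<open>j\<close> and \<open>i\<close> add up to at
    most \<open>m + k\<close>.\<close>
  from assms obtain M where M: "\<And>f x i. f \<in> B \<Longrightarrow> x \<in> cball 0 (Q + R) \<Longrightarrow> i \<le> m + k \<Longrightarrow>
      cmod ((vderiv ^^ i) (Cinf_fun f) x) \<le> M"
    unfolding lcs_bounded_Cinf_iff by meson
  have "cmod ((vderiv ^^ j) (Cinf_fun g) y) \<le> M"
    if g: "g \<in> ?B'" and y: "y \<in> cball 0 R" "j \<le> m" for g y j
  proof -
    from g obtain x i f where f: "g = translate x (Cinf_deriv i f)" "\<bar>x\<bar> \<le> Q" "i \<le> k" "f \<in> B"
      by auto
    then show ?thesis
      unfolding f(1) vderiv_translate vderiv_Cinf_deriv using y by (intro M) auto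
  qed
  then show "\<exists>M. \<forall>g\<in>?B'. \<forall>y\<in>cball 0 R. \<forall>j\<le>m. cmod ((vderiv ^^ j) (Cinf_fun g) y) \<le> M"
    by blast
qed

text \<open>A bounded set of distributions is uniformly bounded on the bounded set of translated
  derivatives, which by \<open>vderiv_conv_test\<close> bounds all derivatives on each ball.\<close>

lemma lcs_bounded_conv_test:
  assumes "lcs_bounded \<T>" "lcs_bounded B"
  shows "lcs_bounded {conv_test T f |T f. T \<in> \<T> \<and> f \<in> B}" (is "lcs_bounded ?B'")
  unfolding lcs_bounded_Cinf_iff
proof (intro allI)
  fix R m
  from assms(1) lcs_bounded_translates[OF assms(2), of R m]
  obtain M where "\<forall>T\<in>\<T>. \<forall>g\<in>{translate x (Cinf_deriv i f) |x i f. x \<in> cball 0 R \<and> i \<le> m \<and> f \<in> B}.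
      cmod (pairing T g) \<le> M"
    unfolding lcs_bounded_Cdistr_iff by meson
  then have "\<forall>g\<in>?B'. \<forall>x\<in>cball 0 R. \<forall>i\<le>m. cmod ((vderiv ^^ i) (Cinf_fun g) x) \<le> M"
    using vderiv_conv_test by fastforce
  then show "\<exists>M. \<forall>g\<in>?B'. \<forall>x\<in>cball 0 R. \<forall>i\<le>m. cmod ((vderiv ^^ i) (Cinf_fun g) x) \<le> M" ..
qed

text \<open>By transposition, \<open>p\<close> can be the supremum over the bounded set of all
  \<open>conv_test T f\<close>. It does not depend on the individual \<open>T\<close>, which is what
  equicontinuity requires.\<close>

lemma conv_seminorm_bound:
  assumes "lcs_bounded \<T>" "q \<in> Cdistr_seminorms"
  obtains p where "p \<in> Cdistr_seminorms" "\<And>T S. T \<in> \<T> \<Longrightarrow> q (T \<star> S) \<le> p S"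
proof -
  from assms(2) obtain B where B: "lcs_bounded B" "B \<noteq> {}" and q: "q = Cdistr_seminorm B"
    by (auto simp: Cdistr_seminorms_def)
  show thesis
  proof (cases "\<T> = {}")
    case True
    \<comment> \<open>The set of test functions would be empty and give no member of
      \<open>Cdistr_seminorms\<close>; the estimate is vacuous, so \<open>q\<close> itself serves as
      \<open>p\<close>.\<close>
    then show thesis using that[OF assms(2)] by simp
  next
    case False
    let ?B' = "{conv_test T f |T f. T \<in> \<T> \<and> f \<in> B}"
    have B': "lcs_bounded ?B'" "?B' \<noteq> {}"
      using lcs_bounded_conv_test[OF assms(1) B(1)] B(2) False by auto
    show thesis
    proof (rule that[of "Cdistr_seminorm ?B'"])
      show "Cdistr_seminorm ?B' \<in> Cdistr_seminorms"
        using B' unfolding Cdistr_seminorms_def by blast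
      show "q (T \<star> S) \<le> Cdistr_seminorm ?B' S" if "T \<in> \<T>" for T S
        unfolding q Cdistr_seminorm_le_iff[OF B] pairing_conv
        using that by (blast intro: Cdistr_seminorm_upper[OF B'(1)])
    qed
  qed
qed

text \<open>The continuity bound of the fixed \<open>S\<close> reduces the claim to a seminorm of
  \<open>conv_test Y f\<close>, hence to values of \<open>Y\<close> on a bounded set of translated
  derivatives. So a strong seminorm of \<open>Y \<star> S\<close> is at most \<open>D\<close> times
  one of \<open>Y\<close>, applied to \<open>Y = X n - T\<close>.\<close>

lemma tendsto_conv_left:
  assumes "(X \<longlongrightarrow> T) F"
  shows "((\<lambda>n. X n \<star> S) \<longlongrightarrow> T \<star> S) F"
  unfolding Cdistr.tendsto_iff_seminorms
proof
  fix q assume "q \<in> Cdistr_seminorms"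
  then obtain B where B: "lcs_bounded B" "B \<noteq> {}" and q: "q = Cdistr_seminorm B"
    by (auto simp: Cdistr_seminorms_def)
  obtain Q D k where Q: "0 \<le> Q" "0 \<le> D"
    and S: "\<And>f. cmod (pairing S f) \<le> D * Cinf_seminorm (cball 0 Q) k f"
    by (rule pairing_bound[of S]) blast
  let ?B' = "{translate x (Cinf_deriv i f) |x i f. x \<in> cball 0 Q \<and> i \<le> k \<and> f \<in> B}"
  have B': "lcs_bounded ?B'" by (rule lcs_bounded_translates[OF B(1)])
  have "\<exists>f. f \<in> B" "(0::real) \<in> cball 0 Q" using B(2) Q by auto
  then have ne: "?B' \<noteq> {}" by blast
  have cb: "compact (cball (0::real) Q)" "cball (0::real) Q \<noteq> {}" using Q by auto
  have le: "q (Y \<star> S) \<le> D * Cdistr_seminorm ?B' Y" for Y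
    unfolding q Cdistr_seminorm_le_iff[OF B] pairing_conv
  proof
    fix f assume f: "f \<in> B"
    have "Cinf_seminorm (cball 0 Q) k (conv_test Y f) \<le> Cdistr_seminorm ?B' Y"
      unfolding Cinf_seminorm_le_iff[OF cb] vderiv_conv_test
      using f by (blast intro: Cdistr_seminorm_upper[OF B'])
    then show "cmod (pairing S (conv_test Y f)) \<le> D * Cdistr_seminorm ?B' Y"
      using S[of "conv_test Y f"] Q(2) by (meson mult_left_mono order_trans)
  qed
  have "Cdistr_seminorm ?B' \<in> Cdistr_seminorms"
    using B' ne unfolding Cdistr_seminorms_def by blast
  then have "((\<lambda>n. Cdistr_seminorm ?B' (X n - T)) \<longlongrightarrow> 0) F"
    using assms Cdistr.tendsto_iff_seminorms by blast
  from tendsto_mult_right_zero[OF this, of D]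
  show "((\<lambda>n. q (X n \<star> S - T \<star> S)) \<longlongrightarrow> 0) F"
  proof (rule tendsto_sandwich[OF _ _ tendsto_const, rotated 2])
    show "\<forall>\<^sub>F n in F. q (X n \<star> S - T \<star> S) \<le> D * Cdistr_seminorm ?B' (X n - T)"
      using le by (simp add: conv_diff_left[symmetric])
    show "\<forall>\<^sub>F n in F. 0 \<le> q (X n \<star> S - T \<star> S)"
      using \<open>q \<in> Cdistr_seminorms\<close> by (simp add: Cdistr.nonneg)
  qed
qed

text \<open>The uniform estimate for the singleton of \<open>T\<close> gives continuity at 0, and
  linearity carries it to every \<open>S0\<close>.\<close>

lemma conv_continuous_linear: "(\<lambda>S. T \<star> S) \<in> continuous_linear_operators"
proof -
  have "((\<lambda>S. T \<star> S) \<longlongrightarrow> T \<star> S0) (at S0)" for S0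
    unfolding Cdistr.tendsto_iff_seminorms
  proof
    fix q assume q: "q \<in> Cdistr_seminorms"
    obtain p where p: "p \<in> Cdistr_seminorms" "\<And>S. q (T \<star> S) \<le> p S"
      by (rule conv_seminorm_bound[OF lcs_bounded_singleton[of T] q]) simp
    have "((\<lambda>S. p (S - S0)) \<longlongrightarrow> 0) (at S0)"
      using p(1) Cdistr.tendsto_iff_seminorms[of "\<lambda>S. S" S0 "at S0"] by simp
    then show "((\<lambda>S. q (T \<star> S - T \<star> S0)) \<longlongrightarrow> 0) (at S0)"
    proof (rule tendsto_sandwich[OF _ _ tendsto_const, rotated 2])
      have "T \<star> S - T \<star> S0 = T \<star> (S - S0)" for S
        using conv_add_right[of T "S - S0" S0] by simp
      then show "\<forall>\<^sub>F S in at S0. q (T \<star> S - T \<star> S0) \<le> p (S - S0)"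
        using p(2) by simp
    qed (simp add: q Cdistr.nonneg)
  qed
  then show ?thesis
    by (simp add: continuous_linear_operators_def linear_operator_iff conv_add_right
        conv_scale_right continuous_on_def)
qed

lemma equicontinuous_conv:
  assumes "lcs_bounded \<T>"
  shows "equicontinuous {\<lambda>S. T \<star> S |T. T \<in> \<T>}"
  unfolding equicontinuous_def
proof (intro conjI allI impI)
  show "{\<lambda>S. T \<star> S |T. T \<in> \<T>} \<subseteq> continuous_linear_operators"
    using conv_continuous_linear by blast
  fix V :: "Cdistr set" assume "open V \<and> 0 \<in> V"
  then obtain F e where F: "finite F" "F \<subseteq> Cdistr_seminorms" "0 < e"
    and V: "\<And>y. (\<And>p. p \<in> F \<Longrightarrow> p (y - 0) < e) \<Longrightarrow> y \<in> V"
    using Cdistr.open_nhd[of V 0] by blast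
  have "\<forall>q\<in>F. \<exists>p. p \<in> Cdistr_seminorms \<and> (\<forall>T\<in>\<T>. \<forall>S. q (T \<star> S) \<le> p S)"
    using F(2) conv_seminorm_bound[OF assms] by (metis subsetD)
  then obtain p where p: "\<And>q. q \<in> F \<Longrightarrow> p q \<in> Cdistr_seminorms"
    "\<And>q T S. q \<in> F \<Longrightarrow> T \<in> \<T> \<Longrightarrow> q (T \<star> S) \<le> p q S" by metis
  \<comment> \<open>Finitely many seminorms, chosen uniformly in \<open>T\<close>, cut out one
    neighbourhood that works for all operators.\<close>
  let ?U = "{S. \<forall>r\<in>p ` F. r (S - 0) < e}"
  have pF: "finite (p ` F)" "p ` F \<subseteq> Cdistr_seminorms" using F(1) p(1) by auto
  have "(\<lambda>S. T \<star> S) ` ?U \<subseteq> V" if T: "T \<in> \<T>" for T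
  proof safe
    fix S assume S: "\<forall>r\<in>p ` F. r (S - 0) < e"
    have "q (T \<star> S) < e" if "q \<in> F" for q
      using p(2)[OF that T, of S] S that by fastforce
    then show "T \<star> S \<in> V" by (intro V) simp
  qed
  then show "\<exists>U. open U \<and> 0 \<in> U \<and> (\<forall>A\<in>{\<lambda>S. T \<star> S |T. T \<in> \<T>}. A ` U \<subseteq> V)"
    using Cdistr.open_ball[OF pF, of 0 e] Cdistr.mem_ball[OF pF(2) F(3), of 0]
    by (intro exI[of _ ?U]) blast
qed

section \<open>Power boundedness and mean ergodicity of convolution operators\<close>

lemma funpow_conv_set:
  "{(\<lambda>S. T \<star> S) ^^ n |n. 1 \<le> n} = {\<lambda>S. R \<star> S |R. R \<in> {conv_power T n |n. 1 \<le> n}}"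
proof -
  have "(\<lambda>S. T \<star> S) ^^ n = (\<lambda>S. conv_power T n \<star> S)" if "1 \<le> n" for n
    using funpow_conv[OF that] by blast
  then show ?thesis by (auto; metis)
qed

lemma power_bounded_conv_iff:
  "power_bounded (\<lambda>S. T \<star> S) \<longleftrightarrow> lcs_bounded {conv_power T n |n. 1 \<le> n}"
proof
  assume "power_bounded (\<lambda>S. T \<star> S)"
  then have "lcs_bounded {A dirac |A. A \<in> {(\<lambda>S. T \<star> S) ^^ n |n. 1 \<le> n}}"
    unfolding power_bounded_def by (intro equicontinuous_imp_orbit_bounded) blast
  \<comment> \<open>Each iterate is convolution with a power, which \<open>conv_dirac\<close>
    recovers.\<close>
  also have "{A dirac |A. A \<in> {(\<lambda>S. T \<star> S) ^^ n |n. 1 \<le> n}} = {conv_power T n |n. 1 \<le> n}"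
    unfolding funpow_conv_set by (auto simp: conv_dirac) (metis conv_dirac)
  finally show "lcs_bounded {conv_power T n |n. 1 \<le> n}" .
next
  assume "lcs_bounded {conv_power T n |n. 1 \<le> n}"
  then show "power_bounded (\<lambda>S. T \<star> S)"
    unfolding power_bounded_def funpow_conv_set
    by (intro conjI conv_continuous_linear equicontinuous_conv)
qed

lemma mean_ergodic_conv_iff:
  "mean_ergodic (\<lambda>S. T \<star> S) \<longleftrightarrow> convergent (\<lambda>n. conv_mean T n)"
proof
  assume "mean_ergodic (\<lambda>S. T \<star> S)"
  then obtain P where "(\<lambda>n. cesaro_mean (\<lambda>S. T \<star> S) n dirac) \<longlonglongrightarrow> P dirac"
    unfolding mean_ergodic_def by blast
  then show "convergent (\<lambda>n. conv_mean T n)"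
    unfolding cesaro_mean_conv conv_dirac by (rule convergentI)
next
  assume "convergent (\<lambda>n. conv_mean T n)"
  then obtain R where "(\<lambda>n. conv_mean T n) \<longlonglongrightarrow> R" unfolding convergent_def by blast
  then have "(\<lambda>n. cesaro_mean (\<lambda>S. T \<star> S) n S) \<longlonglongrightarrow> R \<star> S" for S
    unfolding cesaro_mean_conv by (rule tendsto_conv_left)
  then show "mean_ergodic (\<lambda>S. T \<star> S)"
    \<comment> \<open>The limit operator is convolution with \<open>R\<close>, hence itself
      continuous and linear.\<close>
    unfolding mean_ergodic_def using conv_continuous_linear by blast
qed

theorem proposition4p9:
  fixes T :: Cdistr
  shows "(power_bounded (\<lambda>S. T \<star> S) \<longleftrightarrow> lcs_bounded {conv_power T n |n. 1 \<le> n}) \<and>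
    (mean_ergodic (\<lambda>S. T \<star> S) \<longleftrightarrow> convergent (\<lambda>n. conv_mean T n))"
  by (intro conjI power_bounded_conv_iff mean_ergodic_conv_iff)

end
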